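(* Let $d\ge1$, $0<\alpha<1$ and $\beta>1$. Let $\{X_{\mathbf k},\mathbf k\in\mathbb Z_+^d\}$ be i.i.d. copies of $X$ with $\mathbb EX=0$, $\operatorname{Var}X=\sigma^2<\infty$, and suppose $$\mathbb E\big(|X|^{2/\alpha}(\log^+|X|)^{d-1-1/\alpha}\big)<\infty.$$ Let $\Lambda^*=\{\lfloor i^{\beta/(1-\alpha)}\rfloor: i\ge1\}$ and write $\mathbf n\in\Lambda^*$ if every coordinate of $\mathbf n$ belongs to $\Lambda^*$. Then $$\limsup_{\mathbf n\to\infty,\ \mathbf n\in\Lambda^*}\frac{T_{\mathbf n,\mathbf n+\mathbf n^\alpha}}{\sqrt{2|\mathbf n|^\alpha\log|\mathbf n|}}=\sigma\sqrt{\frac{1-\alpha}{\beta}},\qquad \liminf_{\mathbf n\to\infty,\ \mathbf n\in\Lambda^*}\frac{T_{\mathbf n,\mathbf n+\mathbf n^\alpha}}{\sqrt{2|\mathbf n|^\alpha\log|\mathbf n|}}=-\sigma\sqrt{\frac{1-\alpha}{\beta}}\quad\text{a.s.}$$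
   Context: $\mathbb Z_+^d$ is the set of $d$-tuples of positive integers with the coordinatewise partial order. $|\mathbf n|=\prod_{k=1}^d n_k$; $\mathbf n\to\infty$ means every coordinate tends to infinity. $\mathbf n^\alpha=(\lfloor n_1^\alpha\rfloor,\dots,\lfloor n_d^\alpha\rfloor)$. For $\mathbf k\in\mathbb Z_{\ge0}^d$, $T_{\mathbf n,\mathbf n+\mathbf k}=\sum X_{\mathbf j}$ over all $\mathbf j\in\mathbb Z_+^d$ with $n_i<j_i\le n_i+k_i$ for every $i$. $\log^+x=\max\{\log x,1\}$. *)

theory Defs
  imports "HOL-Probability.Probability"
begin

definition logp :: "real \<Rightarrow> real" where
  "logp x = max (ln x) 1"

definition Zplus :: "('d::finite \<Rightarrow> nat) set" where
  "Zplus = {k. \<forall>i. 1 \<le> k i}"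

definition mabs :: "('d::finite \<Rightarrow> nat) \<Rightarrow> nat" where
  "mabs n = (\<Prod>i\<in>UNIV. n i)"

definition mpow :: "('d::finite \<Rightarrow> nat) \<Rightarrow> real \<Rightarrow> ('d \<Rightarrow> nat)" where
  "mpow n a = (\<lambda>i. nat \<lfloor>real (n i) powr a\<rfloor>)"

definition Tsum :: "(('d::finite \<Rightarrow> nat) \<Rightarrow> 'a \<Rightarrow> real) \<Rightarrow> ('d \<Rightarrow> nat) \<Rightarrow> ('d \<Rightarrow> nat) \<Rightarrow> 'a \<Rightarrow> real" where
  "Tsum X n k \<omega> = (\<Sum>j\<in>{j. \<forall>i. n i < j i \<and> j i \<le> n i + k i}. X j \<omega>)"

definition Lambda_star :: "real \<Rightarrow> real \<Rightarrow> nat set" where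
  "Lambda_star a b = {nat \<lfloor>real i powr (b / (1 - a))\<rfloor> | i::nat. i \<ge> 1}"

definition multi_at_top :: "('d::finite \<Rightarrow> nat) filter" where
  "multi_at_top = (INF i. filtercomap (\<lambda>n. n i) at_top)"

definition multi_at_top_in :: "nat set \<Rightarrow> ('d::finite \<Rightarrow> nat) filter" where
  "multi_at_top_in L = inf multi_at_top (principal {n. \<forall>i. n i \<in> L})"

end

theory Submission
  imports Defs "HOL-Real_Asymp.Real_Asymp"
begin

text \<open>
  Write \<open>\<tau> = (1 - \<alpha>) / \<beta>\<close>. Both bounds come from the fact that the probability of
  \<open>T > c \<surd>(2 |n|\<^sup>\<alpha> log |n|)\<close> is \<open>|n|\<close> to the power \<open>- c\<^sup>2 / \<sigma>\<^sup>2 + o(1)\<close>, while the sum of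
  \<open>|n|\<close> to the power \<open>- \<theta>\<close> over the indices with coordinates in \<open>\<Lambda>\<^sup>*\<close> factorises over the coordinates
  and converges iff \<open>\<theta> > \<tau>\<close>.

  For the upper bound, truncate the summands at a small multiple of \<open>\<surd>(|n|\<^sup>\<alpha> / log |n|)\<close> and use
  Chernoff's inequality. Because \<open>\<beta> > 1\<close>, a moment of some order \<open>p < 2 / \<alpha>\<close> makes the truncation
  error summable, and Borel-Cantelli applies.

  For the lower bound, cut the block into about \<open>log |n|\<close> pieces and ask each partial sum to exceed a
  large constant multiple of its standard deviation; the central limit theorem bounds the probability
  of this from below. Consecutive elements of \<open>\<Lambda>\<^sup>*\<close> are so far apart that the blocks along a
  coordinate direction are eventually disjoint, so the second Borel-Cantelli lemma applies.
  The statement on the lower limit is the one on the upper limit for \<open>- X\<close>.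
\<close>

section \<open>Moderate deviations of i.i.d. sums\<close>

text \<open>Each sum factors through the restriction of the family to its own block, and
  restrictions to disjoint blocks are independent.\<close>

lemma (in prob_space) indep_vars_block_sums:
  fixes X :: "'i \<Rightarrow> 'a \<Rightarrow> real"
  assumes ind: "indep_vars (\<lambda>_. borel) X I"
    and K: "\<And>j. j \<in> L \<Longrightarrow> K j \<subseteq> I" and disj: "disjoint_family_on K L"
  shows "indep_vars (\<lambda>_. borel) (\<lambda>j \<omega>. \<Sum>i\<in>K j. X i \<omega>) L"
proof -
  have "indep_vars (\<lambda>_. borel) (\<lambda>j \<omega>. \<Sum>i\<in>K j. restrict (\<lambda>i. X i \<omega>) (K j) i) L"
    by (rule indep_vars_compose2[OF indep_vars_restrict[OF ind K disj]])
       (auto intro!: borel_measurable_sum measurable_component_singleton)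
  then show ?thesis
    by simp
qed

section \<open>Block sums of an i.i.d. family\<close>

text \<open>\<open>X0\<close> only carries the common law. It need not belong to the family, so
  moment hypotheses can be stated without choosing an index.\<close>

locale iid_family = prob_space M for M :: "'a measure" +
  fixes X :: "'i \<Rightarrow> 'a \<Rightarrow> real" and I :: "'i set" and X0 :: "'a \<Rightarrow> real"
  assumes X0_measurable [measurable]: "X0 \<in> borel_measurable M"
    and indep: "indep_vars (\<lambda>_. borel) X I"
    and identical: "k \<in> I \<Longrightarrow> distr M borel (X k) = distr M borel X0"
begin

lemma X_measurable: "k \<in> I \<Longrightarrow> X k \<in> borel_measurable M"
  using indep by (auto simp: indep_vars_def)

lemma sum_measurable [measurable]: "J \<subseteq> I \<Longrightarrow> (\<lambda>\<omega>. \<Sum>j\<in>J. X j \<omega>) \<in> borel_measurable M"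
  by (intro borel_measurable_sum X_measurable) auto

lemma transfer_nn_integral:
  assumes "k \<in> I" and [measurable]: "f \<in> borel_measurable borel"
  shows "(\<integral>\<^sup>+\<omega>. f (X k \<omega>) \<partial>M) = (\<integral>\<^sup>+\<omega>. f (X0 \<omega>) \<partial>M)"
proof -
  have [measurable]: "X k \<in> borel_measurable M" using assms X_measurable by auto
  show ?thesis
    using nn_integral_distr[of "X k" M borel f] nn_integral_distr[of X0 M borel f] identical[OF assms(1)]
    by simp
qed

lemma transfer_prob:
  assumes "k \<in> I" and A: "A \<in> sets borel"
  shows "prob {\<omega>\<in>space M. X k \<omega> \<in> A} = prob {\<omega>\<in>space M. X0 \<omega> \<in> A}"
proof -
  have [measurable]: "X k \<in> borel_measurable M" using assms X_measurable by auto
  have "prob (X k -` A \<inter> space M) = prob (X0 -` A \<inter> space M)"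
    using measure_distr[of "X k" M borel A] measure_distr[of X0 M borel A] identical[OF assms(1)] A by simp
  then show ?thesis by (simp add: vimage_def Int_def conj_commute)
qed

text \<open>Induction removing one index from each set: by independence, the law of the sum is the
  convolution of the law of \<open>X0\<close> with the law of the remaining sum.\<close>

lemma distr_sum_eq:
  assumes "finite J" "J \<subseteq> I" "finite J'" "J' \<subseteq> I" "card J = card J'"
  shows "distr M borel (\<lambda>\<omega>. \<Sum>j\<in>J. X j \<omega>) = distr M borel (\<lambda>\<omega>. \<Sum>j\<in>J'. X j \<omega>)"
  using assms
proof (induction J arbitrary: J' rule: finite_induct)
  case empty
  then show ?case by simp
next
  case (insert a J)
  then obtain b J1 where J': "J' = insert b J1" "b \<notin> J1" "finite J1" "card J1 = card J"
    by (metis card_Suc_eq card_insert_disjoint finite_insert)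
  have step: "distr M borel (\<lambda>\<omega>. \<Sum>j\<in>insert c D. X j \<omega>) =
      convolution (distr M borel X0) (distr M borel (\<lambda>\<omega>. \<Sum>j\<in>D. X j \<omega>))"
    if "finite D" "c \<notin> D" "insert c D \<subseteq> I" for c D
  proof -
    have "distr M borel (\<lambda>\<omega>. X c \<omega> + (\<Sum>j\<in>D. X j \<omega>)) =
        convolution (distr M borel (X c)) (distr M borel (\<lambda>\<omega>. \<Sum>j\<in>D. X j \<omega>))"
      using that X_measurable
      by (intro sum_indep_random_variable indep_vars_sum indep_vars_subset[OF indep] sum_measurable) auto
    then show ?thesis using that identical[of c] by simp
  qed
  have "distr M borel (\<lambda>\<omega>. \<Sum>j\<in>J. X j \<omega>) = distr M borel (\<lambda>\<omega>. \<Sum>j\<in>J1. X j \<omega>)"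
    using insert.prems J' by (intro insert.IH) auto
  then show ?case
    using step[of J a] step[of J1 b] insert.prems insert.hyps J' by simp
qed

lemma prob_sum_gt_eq:
  assumes "finite J" "J \<subseteq> I" "finite J'" "J' \<subseteq> I" "card J = card J'"
  shows "prob {\<omega>\<in>space M. (\<Sum>j\<in>J. X j \<omega>) > y} = prob {\<omega>\<in>space M. (\<Sum>j\<in>J'. X j \<omega>) > y}"
proof -
  have [measurable]: "(\<lambda>\<omega>. \<Sum>j\<in>J. X j \<omega>) \<in> borel_measurable M" "(\<lambda>\<omega>. \<Sum>j\<in>J'. X j \<omega>) \<in> borel_measurable M"
    using assms by auto
  have "measure (distr M borel (\<lambda>\<omega>. \<Sum>j\<in>J. X j \<omega>)) {y<..} = measure (distr M borel (\<lambda>\<omega>. \<Sum>j\<in>J'. X j \<omega>)) {y<..}"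
    using distr_sum_eq[OF assms] by simp
  then show ?thesis
    by (simp add: measure_distr vimage_def Int_def conj_commute)
qed

text \<open>The two events are independent, and together they force the sum over the union above
  \<open>y + z\<close>.\<close>

lemma prob_sum_gt_superadditive:
  assumes "finite J" "J \<subseteq> I" "finite J'" "J' \<subseteq> I" "J \<inter> J' = {}"
  shows "prob {\<omega>\<in>space M. (\<Sum>j\<in>J. X j \<omega>) > y} * prob {\<omega>\<in>space M. (\<Sum>j\<in>J'. X j \<omega>) > z}
    \<le> prob {\<omega>\<in>space M. (\<Sum>j\<in>J\<union>J'. X j \<omega>) > y + z}"
proof -
  have [measurable]: "(\<lambda>\<omega>. \<Sum>j\<in>J. X j \<omega>) \<in> borel_measurable M" "(\<lambda>\<omega>. \<Sum>j\<in>J'. X j \<omega>) \<in> borel_measurable M"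
    "(\<lambda>\<omega>. \<Sum>j\<in>J\<union>J'. X j \<omega>) \<in> borel_measurable M"
    using assms by (auto intro!: sum_measurable)
  \<comment> \<open>The two blocks are treated as a family indexed by the booleans, so that the
    block-sum lemma applies.\<close>
  let ?K = "\<lambda>b. if b then J else J'" and ?A = "\<lambda>b. if b then {y<..} else {z<..}"
  let ?S = "\<lambda>b \<omega>. \<Sum>j\<in>?K b. X j \<omega>"
  have "indep_vars (\<lambda>_. borel) ?S UNIV"
    using assms by (intro indep_vars_block_sums[OF indep]) (auto simp: disjoint_family_on_def)
  then have "prob (\<Inter>b\<in>UNIV. ?S b -` ?A b \<inter> space M) = (\<Prod>b\<in>UNIV. prob (?S b -` ?A b \<inter> space M))"
    by (rule indep_varsD) auto
  also have "\<dots> = prob {\<omega>\<in>space M. (\<Sum>j\<in>J. X j \<omega>) > y} * prob {\<omega>\<in>space M. (\<Sum>j\<in>J'. X j \<omega>) > z}"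
    by (simp add: UNIV_bool vimage_def Int_def conj_commute mult.commute)
  finally have eq: "prob {\<omega>\<in>space M. (\<Sum>j\<in>J. X j \<omega>) > y} * prob {\<omega>\<in>space M. (\<Sum>j\<in>J'. X j \<omega>) > z}
     = prob (\<Inter>b\<in>UNIV. ?S b -` ?A b \<inter> space M)" by simp
  also have "\<dots> \<le> prob {\<omega>\<in>space M. (\<Sum>j\<in>J\<union>J'. X j \<omega>) > y + z}"
    using assms by (intro finite_measure_mono) (auto simp: UNIV_bool sum.union_disjoint)
  finally show ?thesis .
qed

text \<open>Blocks of exactly \<open>q0\<close> indices are peeled off one at a time. Surplus
  indices stay in the last block, which is why the hypothesis covers all sets with at least
  \<open>q0\<close> elements.\<close>

lemma prob_sum_gt_power:
  assumes q: "\<And>J. finite J \<Longrightarrow> J \<subseteq> I \<Longrightarrow> card J \<ge> q0 \<Longrightarrow> prob {\<omega>\<in>space M. (\<Sum>j\<in>J. X j \<omega>) > z} \<ge> p0"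
    and "p0 \<ge> 0" "m \<ge> 1" "finite J" "J \<subseteq> I" "card J \<ge> m * q0"
  shows "prob {\<omega>\<in>space M. (\<Sum>j\<in>J. X j \<omega>) > real m * z} \<ge> p0 ^ m"
  using \<open>m \<ge> 1\<close> assms(4-)
proof (induction m arbitrary: J rule: dec_induct)
  case base
  then show ?case using q[of J] by simp
next
  case (step m)
  then obtain J1 where J1: "J1 \<subseteq> J" "card J1 = q0"
    by (metis obtain_subset_with_card_n le_add1 le_trans mult_Suc)
  define J2 where "J2 = J - J1"
  have fin: "finite J1" "finite J2" using step J1 by (auto simp: J2_def intro: finite_subset)
  have c2: "card J2 \<ge> m * q0"
    using step.prems J1 fin by (simp add: J2_def card_Diff_subset)
  have "p0 * p0 ^ m \<le> prob {\<omega>\<in>space M. (\<Sum>j\<in>J1. X j \<omega>) > z} * prob {\<omega>\<in>space M. (\<Sum>j\<in>J2. X j \<omega>) > real m * z}"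
    using step.prems J1 fin c2 \<open>p0 \<ge> 0\<close>
    by (intro mult_mono step.IH q) (auto simp: J2_def)
  also have "\<dots> \<le> prob {\<omega>\<in>space M. (\<Sum>j\<in>J1\<union>J2. X j \<omega>) > z + real m * z}"
    using step.prems J1 fin by (intro prob_sum_gt_superadditive) (auto simp: J2_def)
  also have "J1 \<union> J2 = J" using J1 by (auto simp: J2_def)
  finally show ?case by (simp add: algebra_simps)
qed

end

section \<open>Upper tail: truncation and an exponential moment\<close>

text \<open>Taylor's formula with second-order remainder. Only an upper bound on \<open>u\<close>
  enters, which suits a variable truncated from above and unbounded below.\<close>

lemma exp_le_quadratic:
  fixes u v :: real
  assumes "u \<le> v" "0 \<le> v"
  shows "exp u \<le> 1 + u + u\<^sup>2 / 2 * exp v"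
proof (cases "u = 0")
  case False
  then obtain t where t: "\<bar>t\<bar> \<le> \<bar>u\<bar>" "exp u = (\<Sum>m<2. u ^ m / fact m) + exp t / fact 2 * u ^ 2"
    using Maclaurin_exp_le[of u 2] by auto
  show ?thesis
  proof (cases "u \<ge> 0")
    case True
    then have "exp t \<le> exp v" using t assms by auto
    then have "exp t * u\<^sup>2 \<le> exp v * u\<^sup>2" by (intro mult_right_mono) auto
    then show ?thesis using t by (simp add: numeral_2_eq_2 mult.commute field_simps)
  next
    \<comment> \<open>The Taylor point \<open>t\<close> is only known to satisfy
      \<open>\<bar>t\<bar> \<le> \<bar>u\<bar>\<close> and might be positive, so negative
      \<open>u\<close> is handled by monotonicity instead.\<close>
    case neg: False
    have "exp u \<le> 1 + u + u\<^sup>2 / 2"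
    proof -
      define f where "f x = 1 + x + x\<^sup>2 / 2 - exp x" for x :: real
      have "f u \<ge> f 0"
      proof (rule DERIV_nonpos_imp_nonincreasing[of u 0 f])
        fix x :: real
        have "(f has_real_derivative (1 + x - exp x)) (at x)"
          unfolding f_def by (auto intro!: derivative_eq_intros)
        then show "\<exists>y. DERIV f x :> y \<and> y \<le> 0"
          using exp_ge_add_one_self[of x] by (intro exI[of _ "1 + x - exp x"]) auto
      qed (use neg in auto)
      then show ?thesis by (simp add: f_def)
    qed
    also have "u\<^sup>2 / 2 \<le> u\<^sup>2 / 2 * exp v" using assms mult_left_mono[of 1 "exp v" "u\<^sup>2 / 2"] by simp
    finally show ?thesis by simp
  qed
qed simp

context iid_family
begin

text \<open>Replacing a summand by 0 when it exceeds \<open>b\<close> only lowers its mean, so the exponential moment of the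
  truncated variable has no first-order term.\<close>

lemma prob_sum_gt_le:
  assumes sq: "integrable M (\<lambda>\<omega>. (X0 \<omega>)\<^sup>2)" and mean: "expectation X0 = 0"
    and var: "expectation (\<lambda>\<omega>. (X0 \<omega>)\<^sup>2) \<le> s"
    and "finite J" "J \<subseteq> I" "h > 0" "b > 0"
  shows "prob {\<omega>\<in>space M. (\<Sum>j\<in>J. X j \<omega>) > y}
    \<le> card J * prob {\<omega>\<in>space M. X0 \<omega> > b} + exp (- h * y + card J * (h\<^sup>2 * s * exp (h * b) / 2))"
proof -
  define \<phi> :: "real \<Rightarrow> real" where "\<phi> x = (if x \<le> b then x else 0)" for x
  have [measurable]: "\<phi> \<in> borel_measurable borel" unfolding \<phi>_def by measurable
  have [measurable]: "X j \<in> borel_measurable M" if "j \<in> J" for j using that assms X_measurable by auto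
  have [measurable]: "(\<lambda>\<omega>. \<Sum>j\<in>J. X j \<omega>) \<in> borel_measurable M" using assms by auto
  have [measurable]: "(\<lambda>\<omega>. \<Sum>j\<in>J. \<phi> (X j \<omega>)) \<in> borel_measurable M" by (intro borel_measurable_sum) measurable
  have int1: "integrable M X0" using sq by (rule square_integrable_imp_integrable[rotated]) simp
  let ?c = "h\<^sup>2 * s * exp (h * b) / 2"
  have mgf: "(\<integral>\<^sup>+\<omega>. ennreal (exp (h * \<phi> (X0 \<omega>))) \<partial>M) \<le> ennreal (exp ?c)"
  proof -
    have int2: "integrable M (\<lambda>\<omega>. \<phi> (X0 \<omega>))"
      by (rule Bochner_Integration.integrable_bound[OF int1]) (auto simp: \<phi>_def)
    have int3: "integrable M (\<lambda>\<omega>. (\<phi> (X0 \<omega>))\<^sup>2)"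
      by (rule Bochner_Integration.integrable_bound[OF sq]) (auto simp: \<phi>_def)
    have "expectation (\<lambda>\<omega>. \<phi> (X0 \<omega>)) \<le> expectation X0"
      using int1 int2 \<open>b > 0\<close> by (intro integral_mono) (auto simp: \<phi>_def)
    then have m0: "expectation (\<lambda>\<omega>. \<phi> (X0 \<omega>)) \<le> 0" using mean by simp
    have "expectation (\<lambda>\<omega>. (\<phi> (X0 \<omega>))\<^sup>2) \<le> expectation (\<lambda>\<omega>. (X0 \<omega>)\<^sup>2)"
      using int3 sq by (intro integral_mono) (auto simp: \<phi>_def)
    then have v0: "expectation (\<lambda>\<omega>. (\<phi> (X0 \<omega>))\<^sup>2) \<le> s" using var by simp
    define g where "g \<omega> = 1 + h * \<phi> (X0 \<omega>) + (h * \<phi> (X0 \<omega>))\<^sup>2 / 2 * exp (h * b)" for \<omega>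
    have g1: "exp (h * \<phi> (X0 \<omega>)) \<le> g \<omega>" for \<omega>
      unfolding g_def using assms by (intro exp_le_quadratic mult_left_mono) (auto simp: \<phi>_def)
    have intg: "integrable M g"
      unfolding g_def power_mult_distrib using int2 int3 by (auto intro!: integrable_divide integrable_mult_left integrable_add)
    have "(\<integral>\<^sup>+\<omega>. ennreal (exp (h * \<phi> (X0 \<omega>))) \<partial>M) \<le> (\<integral>\<^sup>+\<omega>. ennreal (g \<omega>) \<partial>M)"
      by (intro nn_integral_mono ennreal_leI g1)
    also have "\<dots> = ennreal (expectation g)"
      by (intro nn_integral_eq_integral intg) (meson AE_I2 g1 exp_ge_zero order_trans)
    also have "expectation g = 1 + h * expectation (\<lambda>\<omega>. \<phi> (X0 \<omega>)) + h\<^sup>2 * expectation (\<lambda>\<omega>. (\<phi> (X0 \<omega>))\<^sup>2) / 2 * exp (h * b)"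
      unfolding g_def power_mult_distrib using int2 int3 by (simp add: prob_space)
    also have "\<dots> \<le> 1 + h * 0 + h\<^sup>2 * s / 2 * exp (h * b)"
      using m0 v0 \<open>h > 0\<close> by (intro add_mono mult_left_mono mult_right_mono divide_right_mono) auto
    also have "\<dots> \<le> exp ?c" using exp_ge_add_one_self[of ?c] by simp
    finally show ?thesis by (simp add: ennreal_leI)
  qed
  have ind: "indep_vars (\<lambda>_. borel) (\<lambda>j \<omega>. exp (h * \<phi> (X j \<omega>))) J"
    by (rule indep_vars_compose2[OF indep_vars_subset[OF indep \<open>J \<subseteq> I\<close>]]) measurable
  have "emeasure M {\<omega>\<in>space M. (\<Sum>j\<in>J. \<phi> (X j \<omega>)) \<ge> y} \<le>
     ennreal (exp (- h * y)) * (\<integral>\<^sup>+\<omega>. ennreal (exp (h * (\<Sum>j\<in>J. \<phi> (X j \<omega>)))) * indicator (space M) \<omega> \<partial>M)"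
    using \<open>h > 0\<close> by (intro Chernoff_ineq_nn_integral_ge) auto
  also have "(\<integral>\<^sup>+\<omega>. ennreal (exp (h * (\<Sum>j\<in>J. \<phi> (X j \<omega>)))) * indicator (space M) \<omega> \<partial>M)
      = (\<integral>\<^sup>+\<omega>. (\<Prod>j\<in>J. ennreal (exp (h * \<phi> (X j \<omega>)))) \<partial>M)"
    using \<open>finite J\<close> by (intro nn_integral_cong) (simp add: sum_distrib_left exp_sum prod_ennreal)
  also have "\<dots> = (\<Prod>j\<in>J. \<integral>\<^sup>+\<omega>. ennreal (exp (h * \<phi> (X j \<omega>))) \<partial>M)"
  proof (rule indep_vars_nn_integral[OF \<open>finite J\<close>])
    show "indep_vars (\<lambda>_. borel) (\<lambda>j \<omega>. ennreal (exp (h * \<phi> (X j \<omega>)))) J"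
      by (rule indep_vars_compose2[OF ind]) measurable
  qed auto
  also have "\<dots> = (\<Prod>j\<in>J. \<integral>\<^sup>+\<omega>. ennreal (exp (h * \<phi> (X0 \<omega>))) \<partial>M)"
    using \<open>J \<subseteq> I\<close> by (intro prod.cong refl transfer_nn_integral[of _ "\<lambda>x. ennreal (exp (h * \<phi> x))"]) auto
  also have "\<dots> \<le> (\<Prod>j\<in>J. ennreal (exp ?c))"
    using mgf by (intro prod_mono_ennreal) auto
  also have "\<dots> = ennreal (exp (card J * ?c))"
    by (simp only: prod_constant ennreal_power[OF exp_ge_zero] exp_of_nat_mult)
  also have "ennreal (exp (- h * y)) * \<dots> = ennreal (exp (- h * y + card J * ?c))"
    by (simp only: exp_add ennreal_mult[OF exp_ge_zero exp_ge_zero])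
  finally have P1: "prob {\<omega>\<in>space M. (\<Sum>j\<in>J. \<phi> (X j \<omega>)) \<ge> y} \<le> exp (- h * y + card J * ?c)"
    by (simp add: emeasure_eq_measure mult_left_mono)
  have UV: "(\<Union>j\<in>J. {\<omega>\<in>space M. X j \<omega> \<in> {b<..}}) \<in> events" "{\<omega>\<in>space M. (\<Sum>j\<in>J. \<phi> (X j \<omega>)) \<ge> y} \<in> events"
    using \<open>finite J\<close> by (intro sets.finite_UN, auto)
  \<comment> \<open>Either some summand exceeds \<open>b\<close>, or truncation changes nothing and
    the truncated sum is as large as the original one.\<close>
  have "prob {\<omega>\<in>space M. (\<Sum>j\<in>J. X j \<omega>) > y} \<le>
     prob ((\<Union>j\<in>J. {\<omega>\<in>space M. X j \<omega> \<in> {b<..}}) \<union> {\<omega>\<in>space M. (\<Sum>j\<in>J. \<phi> (X j \<omega>)) \<ge> y})"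
  proof (rule finite_measure_mono)
    show "{\<omega>\<in>space M. (\<Sum>j\<in>J. X j \<omega>) > y} \<subseteq> 
      (\<Union>j\<in>J. {\<omega>\<in>space M. X j \<omega> \<in> {b<..}}) \<union> {\<omega>\<in>space M. (\<Sum>j\<in>J. \<phi> (X j \<omega>)) \<ge> y}"
    proof (clarsimp simp: not_le)
      fix \<omega> assume *: "y < (\<Sum>j\<in>J. X j \<omega>)" "\<forall>j\<in>J. \<not> b < X j \<omega>"
      have "(\<Sum>j\<in>J. \<phi> (X j \<omega>)) = (\<Sum>j\<in>J. X j \<omega>)" using * by (intro sum.cong) (auto simp: \<phi>_def)
      then show "y \<le> (\<Sum>j\<in>J. \<phi> (X j \<omega>))" using * by simp
    qed
  qed (use UV in blast)
  also have "\<dots> \<le> prob (\<Union>j\<in>J. {\<omega>\<in>space M. X j \<omega> \<in> {b<..}}) + prob {\<omega>\<in>space M. (\<Sum>j\<in>J. \<phi> (X j \<omega>)) \<ge> y}"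
    using UV by (intro measure_Un_le)
  also have "prob (\<Union>j\<in>J. {\<omega>\<in>space M. X j \<omega> \<in> {b<..}}) \<le> (\<Sum>j\<in>J. prob {\<omega>\<in>space M. X j \<omega> \<in> {b<..}})"
    using \<open>finite J\<close> by (intro measure_UNION_le) auto
  also have "\<dots> = card J * prob {\<omega>\<in>space M. X0 \<omega> \<in> {b<..}}"
    using \<open>J \<subseteq> I\<close> transfer_prob[of _ "{b<..}"] by (simp add: subset_iff)
  finally show ?thesis using P1 by simp
qed

end

section \<open>Lower tail: central limit theorem and block splitting\<close>

text \<open>The mass of the interval from \<open>u\<close> to \<open>u + 1\<close> is at least the
  density at \<open>u + 1\<close>, whose exponent beats
  \<open>- (1 + \<delta>) * u\<^sup>2 / 2\<close> once \<open>u\<close> is large.\<close>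

lemma std_normal_tail_lower_bound:
  assumes "\<delta> > 0"
  shows "\<exists>u>0. exp (- (1 + \<delta>) * u\<^sup>2 / 2) < measure std_normal_distribution {u<..}"
proof -
  interpret N: real_distribution std_normal_distribution by (rule real_dist_normal_dist)
  \<comment> \<open>This expression is the difference of the two exponents, with the normalising
    factor of the density written as a logarithm.\<close>
  have "\<forall>\<^sub>F u in at_top. \<delta> * u\<^sup>2 / 2 - u - 1 / 2 - ln (sqrt (2 * pi)) > 0"
    using assms by real_asymp
  then have "\<forall>\<^sub>F u in at_top. exp (- (1 + \<delta>) * u\<^sup>2 / 2) < exp (- (u + 1)\<^sup>2 / 2) / sqrt (2 * pi)"
  proof eventually_elim
    case (elim u)
    have "- (1 + \<delta>) * u\<^sup>2 / 2 = - (u + 1)\<^sup>2 / 2 + u + 1 / 2 - \<delta> * u\<^sup>2 / 2"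
      by (simp add: power2_eq_square field_simps)
    then have "exp (- (1 + \<delta>) * u\<^sup>2 / 2) < exp (- (u + 1)\<^sup>2 / 2 - ln (sqrt (2 * pi)))"
      using elim by (simp only: exp_less_cancel_iff)
    also have "\<dots> = exp (- (u + 1)\<^sup>2 / 2) / sqrt (2 * pi)" by (simp only: exp_diff) simp
    finally show ?case .
  qed
  then obtain u where u: "u > 0" "exp (- (1 + \<delta>) * u\<^sup>2 / 2) < exp (- (u + 1)\<^sup>2 / 2) / sqrt (2 * pi)"
    using eventually_happens[OF eventually_conj[OF _ eventually_gt_at_top[of 0]]] by auto
  let ?c = "exp (- (u + 1)\<^sup>2 / 2) / sqrt (2 * pi)"
  have "ennreal ?c = (\<integral>\<^sup>+x. ennreal ?c * indicator {u<..u+1} x \<partial>lborel)"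
    by (simp add: nn_integral_cmult_indicator)
  also have "\<dots> \<le> (\<integral>\<^sup>+x. ennreal (std_normal_density x) * indicator {u<..} x \<partial>lborel)"
  proof (intro nn_integral_mono)
    fix x :: real
    show "ennreal ?c * indicator {u<..u+1} x \<le> ennreal (std_normal_density x) * indicator {u<..} x"
    proof (cases "x \<in> {u<..u+1}")
      case True
      then have "x\<^sup>2 \<le> (u+1)\<^sup>2" using u by (intro power_mono) auto
      then have "?c \<le> std_normal_density x" by (simp add: std_normal_density_def divide_right_mono)
      then show ?thesis using True by (auto intro!: ennreal_leI)
    qed auto
  qed
  also have "\<dots> = emeasure std_normal_distribution {u<..}"
    by (simp add: emeasure_density)
  finally have "?c \<le> measure std_normal_distribution {u<..}"
    by (simp add: N.emeasure_eq_measure)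
  then show ?thesis using u by (intro exI[of _ u]) auto
qed

context iid_family
begin

text \<open>The central limit theorem is applied along an injective sequence of indices. Since the
  law of a block sum depends only on the number of summands, the threshold obtained serves every
  finite set of indices.\<close>

lemma clt_tail:
  assumes "infinite I" and sq: "integrable M (\<lambda>\<omega>. (X0 \<omega>)\<^sup>2)" and mean: "expectation X0 = 0"
    and var: "variance X0 = \<sigma>\<^sup>2" and "\<sigma> > 0" and p: "p < measure std_normal_distribution {u<..}"
  shows "\<exists>Q. \<forall>J. finite J \<longrightarrow> J \<subseteq> I \<longrightarrow> card J \<ge> Q \<longrightarrow>
     prob {\<omega>\<in>space M. (\<Sum>j\<in>J. X j \<omega>) > u * \<sigma> * sqrt (card J)} \<ge> p"
proof -
  interpret N: real_distribution std_normal_distribution by (rule real_dist_normal_dist)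
  obtain e :: "nat \<Rightarrow> 'i" where e: "inj e" "range e \<subseteq> I"
    using infinite_countable_subset[OF \<open>infinite I\<close>] by auto
  have [measurable]: "X (e n) \<in> borel_measurable M" for n using e X_measurable by blast
  \<comment> \<open>Singleton blocks reindex the family along \<open>e\<close>.\<close>
  have "indep_vars (\<lambda>_. borel) (\<lambda>n \<omega>. \<Sum>i\<in>{e n}. X i \<omega>) UNIV"
    using e by (intro indep_vars_block_sums[OF indep]) (auto simp: disjoint_family_on_def inj_def)
  then have ind: "indep_vars (\<lambda>_. borel) (\<lambda>n. X (e n)) UNIV" by simp
  have ident: "distr M borel (X (e n)) = distr M borel X0" for n using e identical by blast
  have tr: "expectation (\<lambda>\<omega>. f (X (e n) \<omega>)) = expectation (\<lambda>\<omega>. f (X0 \<omega>))"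
    if [measurable]: "f \<in> borel_measurable borel" for n and f :: "real \<Rightarrow> real"
    using integral_distr[of "X (e n)" M borel f] integral_distr[of X0 M borel f] ident[of n] by simp
  have mean': "expectation (X (e n)) = 0" for n using tr[of "\<lambda>x. x" n] mean by simp
  have sq': "integrable M (\<lambda>\<omega>. (X (e n) \<omega>)\<^sup>2)" for n
    using integrable_distr_eq[of "X (e n)" M borel "\<lambda>x. x\<^sup>2"] integrable_distr_eq[of X0 M borel "\<lambda>x. x\<^sup>2"] ident[of n] sq
    by simp
  have var': "variance (X (e n)) = \<sigma>\<^sup>2" for n
    using tr[of "\<lambda>x. x\<^sup>2" n] var mean mean' by simp
  let ?D = "\<lambda>n. distr M borel (\<lambda>x. (\<Sum>i<n. X (e i) x) / sqrt (real n * \<sigma>\<^sup>2))"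
  have "weak_conv_m ?D std_normal_distribution"
    using central_limit_theorem[OF ind mean' \<open>\<sigma> > 0\<close> sq' var' ident] by simp
  moreover have "isCont (cdf std_normal_distribution) u"
  proof -
    have "emeasure std_normal_distribution {u} = 0"
      by (simp add: emeasure_density nn_integral_indicator_singleton)
    then show ?thesis by (simp add: N.isCont_cdf N.emeasure_eq_measure)
  qed
  ultimately have lim: "(\<lambda>n. cdf (?D n) u) \<longlonglongrightarrow> cdf std_normal_distribution u"
    by (auto simp: weak_conv_m_def weak_conv_def)
  have "cdf std_normal_distribution u = 1 - measure std_normal_distribution {u<..}"
  proof -
    have "measure std_normal_distribution (space std_normal_distribution - {u<..}) = 1 - measure std_normal_distribution {u<..}"
      by (rule N.prob_compl) simp
    moreover have "space std_normal_distribution - {u<..} = {..u}" by auto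
    ultimately show ?thesis by (simp add: cdf_def)
  qed
  then have "cdf std_normal_distribution u < 1 - p" using p by simp
  then have "eventually (\<lambda>n. cdf (?D n) u < 1 - p) sequentially"
    using order_tendstoD(2)[OF lim] by simp
  then obtain Q where Q: "\<And>n. n \<ge> Q \<Longrightarrow> cdf (?D n) u < 1 - p"
    by (auto simp: eventually_sequentially)
  show ?thesis
  \<comment> \<open>The 1 keeps the normalisation \<open>sqrt (real n * \<sigma>\<^sup>2)\<close>
    positive.\<close>
  proof (intro exI[of _ "max Q 1"] allI impI)
    fix J assume J: "finite J" "J \<subseteq> I" "max Q 1 \<le> card J"
    let ?n = "card J"
    interpret D: real_distribution "?D ?n" by (rule real_distribution_distr) measurable
    have "1 - cdf (?D ?n) u = measure (?D ?n) {u<..}"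
    proof -
      have "measure (?D ?n) (space (?D ?n) - {u<..}) = 1 - measure (?D ?n) {u<..}"
        by (rule D.prob_compl) simp
      moreover have "space (?D ?n) - {u<..} = {..u}" by auto
      ultimately show ?thesis by (simp add: cdf_def)
    qed
    then have "p \<le> measure (?D ?n) {u<..}" using Q[of ?n] J by simp
    also have "\<dots> = prob {\<omega>\<in>space M. (\<Sum>i<?n. X (e i) \<omega>) / sqrt (real ?n * \<sigma>\<^sup>2) > u}"
      by (subst measure_distr) (auto simp: vimage_def Int_def conj_commute)
    also have "\<dots> = prob {\<omega>\<in>space M. (\<Sum>i<?n. X (e i) \<omega>) > u * \<sigma> * sqrt ?n}"
      using J \<open>\<sigma> > 0\<close> by (intro arg_cong[where f=prob] Collect_cong conj_cong refl)
        (subst pos_less_divide_eq, auto simp: real_sqrt_mult mult_ac)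
    also have "(\<lambda>\<omega>. \<Sum>i<?n. X (e i) \<omega>) = (\<lambda>\<omega>. \<Sum>j\<in>e ` {..<?n}. X j \<omega>)"
      using e by (subst sum.reindex) (auto intro: inj_on_subset)
    then have "prob {\<omega>\<in>space M. (\<Sum>i<?n. X (e i) \<omega>) > u * \<sigma> * sqrt ?n} = 
       prob {\<omega>\<in>space M. (\<Sum>j\<in>e ` {..<?n}. X j \<omega>) > u * \<sigma> * sqrt ?n}"
      by (simp add: fun_eq_iff)
    also have "\<dots> = prob {\<omega>\<in>space M. (\<Sum>j\<in>J. X j \<omega>) > u * \<sigma> * sqrt ?n}"
    proof (rule prob_sum_gt_eq)
      show "card (e ` {..<?n}) = card J" using e by (simp add: card_image inj_on_subset[OF e(1)])
    qed (use J e in auto)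
    finally show "p \<le> prob {\<omega>\<in>space M. (\<Sum>j\<in>J. X j \<omega>) > u * \<sigma> * sqrt ?n}" .
  qed
qed

text \<open>Splitting \<open>J\<close> into about \<open>L\<close> blocks, on each of which the sum exceeds a fixed large multiple of its
  standard deviation, reduces a moderate deviation to the central limit theorem.\<close>

lemma moderate_deviation_lower_bound:
  assumes "infinite I" and "integrable M (\<lambda>\<omega>. (X0 \<omega>)\<^sup>2)" and "expectation X0 = 0"
    and "variance X0 = \<sigma>\<^sup>2" and "\<sigma> > 0" and "c > 0" and "\<delta> > 0"
  shows "\<exists>C>0. \<exists>R. \<forall>J. \<forall>L::real. finite J \<longrightarrow> J \<subseteq> I \<longrightarrow> 1 \<le> L \<longrightarrow> R * L \<le> real (card J) \<longrightarrow>
     C * exp (- ((1 + \<delta>)\<^sup>2 * c\<^sup>2 / \<sigma>\<^sup>2 * L)) \<le> prob {\<omega>\<in>space M. (\<Sum>j\<in>J. X j \<omega>) > c * sqrt (2 * real (card J) * L)}"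
proof -
  obtain u where u: "u > 0" "exp (- (1 + \<delta>) * u\<^sup>2 / 2) < measure std_normal_distribution {u<..}"
    using std_normal_tail_lower_bound[OF \<open>\<delta> > 0\<close>] by auto
  let ?p = "exp (- (1 + \<delta>) * u\<^sup>2 / 2)"
  obtain Q where Q: "\<And>J. finite J \<Longrightarrow> J \<subseteq> I \<Longrightarrow> card J \<ge> Q \<Longrightarrow>
      prob {\<omega>\<in>space M. (\<Sum>j\<in>J. X j \<omega>) > u * \<sigma> * sqrt (card J)} \<ge> ?p"
    using clt_tail[OF assms(1-5) u(2)] by blast
  \<comment> \<open>With about \<open>A * L\<close> blocks of equal size, each sum exceeding
    \<open>u * \<sigma>\<close> times the root of its size, the total is about
    \<open>u * \<sigma> * sqrt (A * L * card J)\<close>. The choice of \<open>A\<close> makes this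
    the target level times \<open>sqrt (1 + \<delta>)\<close>, a margin for rounding.\<close>
  define A where "A = 2 * c\<^sup>2 * (1 + \<delta>) / (\<sigma>\<^sup>2 * u\<^sup>2)"
  \<comment> \<open>The first entry makes every block large enough for the central limit theorem.
    The second makes the at most \<open>m\<close> indices lost in rounding a fraction of at most
    \<open>\<delta> / (1 + \<delta>)\<close> of \<open>J\<close>.\<close>
  define R where "R = max (real Q) ((1 + \<delta>) / \<delta>)"
  have "A > 0" using assms u by (simp add: A_def)
  have "R \<ge> 0" by (simp add: R_def)
  show ?thesis
  proof (rule exI[of _ ?p], rule conjI, simp, rule exI[of _ "R * (A + 1)"], intro allI impI)
    fix J and L :: real assume J: "finite J" "J \<subseteq> I" and L: "1 \<le> L" "R * (A + 1) * L \<le> real (card J)"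
    define m where "m = nat \<lceil>A * L\<rceil>"
    define q where "q = card J div m"
    have AL: "A * L > 0" using \<open>A > 0\<close> L by simp
    have m: "A * L \<le> real m" "real m < A * L + 1" "m \<ge> 1"
      unfolding m_def using AL by linarith+
    have "real m \<le> (A + 1) * L" using m L by (simp add: algebra_simps)
    then have "R * real m \<le> R * ((A + 1) * L)" using \<open>R \<ge> 0\<close> by (rule mult_left_mono)
    then have Rm: "R * real m \<le> card J" using L by (simp add: mult.assoc)
    have "real Q * real m \<le> R * real m" by (intro mult_right_mono) (auto simp: R_def)
    then have "real (Q * m) \<le> real (card J)" using Rm by simp
    then have "Q * m \<le> card J" by (simp only: of_nat_le_iff)
    then have qQ: "q \<ge> Q" using m by (simp add: q_def less_eq_div_iff_mult_less_eq)
    have "(1 + \<delta>) / \<delta> * real m \<le> R * real m" by (intro mult_right_mono) (auto simp: R_def)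
    then have "(1 + \<delta>) / \<delta> * real m \<le> card J" using Rm by simp
    then have "(1 + \<delta>) * (card J - real m) \<ge> card J" using \<open>\<delta> > 0\<close> by (simp add: field_simps)
    have mq: "m * q \<le> card J" by (simp add: q_def)
    have "card J mod m < m" using m by simp
    moreover have "card J = m * q + card J mod m" by (simp add: q_def)
    ultimately have "card J \<le> m * q + m" by linarith
    then have mq2: "real (card J) - m \<le> real m * real q"
      by (metis of_nat_add of_nat_le_iff of_nat_mult diff_le_eq)
    have step: "?p \<le> prob {\<omega>\<in>space M. (\<Sum>j\<in>J. X j \<omega>) > u * \<sigma> * sqrt q}"
      if "finite J" "J \<subseteq> I" "card J \<ge> q" for J
    proof -
      have [measurable]: "(\<lambda>\<omega>. \<Sum>j\<in>J. X j \<omega>) \<in> borel_measurable M" using that by auto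
      have "u * \<sigma> * sqrt q \<le> u * \<sigma> * sqrt (card J)"
        using u \<open>\<sigma> > 0\<close> that by (intro mult_left_mono) auto
      then have "prob {\<omega>\<in>space M. (\<Sum>j\<in>J. X j \<omega>) > u * \<sigma> * sqrt (card J)} \<le> 
          prob {\<omega>\<in>space M. (\<Sum>j\<in>J. X j \<omega>) > u * \<sigma> * sqrt q}"
        by (intro finite_measure_mono) auto
      then show ?thesis using Q[of J] that qQ by simp
    qed
    have "?p ^ m \<le> prob {\<omega>\<in>space M. (\<Sum>j\<in>J. X j \<omega>) > real m * (u * \<sigma> * sqrt q)}"
      using J m mq step by (intro prob_sum_gt_power) auto
    also have "\<dots> \<le> prob {\<omega>\<in>space M. (\<Sum>j\<in>J. X j \<omega>) > c * sqrt (2 * real (card J) * L)}"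
    proof -
      have [measurable]: "(\<lambda>\<omega>. \<Sum>j\<in>J. X j \<omega>) \<in> borel_measurable M" using J by auto
      have "(c * sqrt (2 * real (card J) * L))\<^sup>2 = 2 * c\<^sup>2 * L * card J"
        using L by (simp add: power_mult_distrib)
      also have "\<dots> \<le> 2 * c\<^sup>2 * L * ((1 + \<delta>) * (card J - real m))"
        using \<open>(1 + \<delta>) * (card J - real m) \<ge> card J\<close> L by (intro mult_left_mono) auto
      also have "\<dots> = u\<^sup>2 * \<sigma>\<^sup>2 * (A * L) * (card J - real m)"
        using u \<open>\<sigma> > 0\<close> by (simp add: A_def)
      also have "\<dots> \<le> u\<^sup>2 * \<sigma>\<^sup>2 * real m * (real m * real q)"
      proof (intro mult_mono mq2 mult_left_mono m)
        have "0 \<le> (1 + \<delta>) * (card J - real m)"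
          using \<open>(1 + \<delta>) * (card J - real m) \<ge> card J\<close> by linarith
        then show "0 \<le> card J - real m" using \<open>\<delta> > 0\<close> by (simp add: zero_le_mult_iff)
      qed (use AL in auto)
      also have "\<dots> = (real m * (u * \<sigma> * sqrt q))\<^sup>2"
        by (simp add: power_mult_distrib power2_eq_square mult_ac)
      finally have "c * sqrt (2 * real (card J) * L) \<le> real m * (u * \<sigma> * sqrt q)"
        using u \<open>\<sigma> > 0\<close> by (elim power2_le_imp_le) auto
      then show ?thesis by (intro finite_measure_mono) auto
    qed
    finally have fin: "?p ^ m \<le> prob {\<omega>\<in>space M. (\<Sum>j\<in>J. X j \<omega>) > c * sqrt (2 * real (card J) * L)}" .
    \<comment> \<open>The prefactor \<open>?p\<close> pays for the extra block that may arise from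
      rounding \<open>A * L\<close> up to \<open>m\<close>.\<close>
    have "?p * exp (- ((1 + \<delta>)\<^sup>2 * c\<^sup>2 / \<sigma>\<^sup>2 * L)) \<le> ?p ^ m"
    proof -
      define B where "B = (1 + \<delta>) * u\<^sup>2 / 2"
      have e1: "(1 + \<delta>)\<^sup>2 * c\<^sup>2 / \<sigma>\<^sup>2 * L = B * (A * L)"
        using u \<open>\<sigma> > 0\<close> by (simp add: A_def B_def power2_eq_square)
      have e2: "- (1 + \<delta>) * u\<^sup>2 / 2 = - B" by (simp add: B_def field_simps)
      have "B * real m \<le> B * (A * L + 1)"
        using m \<open>\<delta> > 0\<close> by (intro mult_left_mono) (auto simp: B_def)
      then have "- (1 + \<delta>) * u\<^sup>2 / 2 + - ((1 + \<delta>)\<^sup>2 * c\<^sup>2 / \<sigma>\<^sup>2 * L) \<le> real m * (- (1 + \<delta>) * u\<^sup>2 / 2)"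
        unfolding e1 e2 by (simp add: algebra_simps)
      then show ?thesis by (simp only: exp_add[symmetric] exp_of_nat_mult[symmetric] exp_le_cancel_iff)
    qed
    then show "?p * exp (- ((1 + \<delta>)\<^sup>2 * c\<^sup>2 / \<sigma>\<^sup>2 * L)) \<le> prob {\<omega>\<in>space M. (\<Sum>j\<in>J. X j \<omega>) > c * sqrt (2 * real (card J) * L)}"
      using fin by (rule order_trans)
  qed
qed

section \<open>Polynomial upper bound for moderate deviations\<close>

text \<open>Both terms of \<open>prob_sum_gt_le\<close> are brought below a multiple of
  \<open>N powr (- \<theta>)\<close>: the exponential one through
  \<open>\<theta> < c\<^sup>2 / s\<close>, the truncation one through Markov's inequality of order
  \<open>p\<close> and \<open>\<theta> < \<alpha> * p / 2 - \<alpha>\<close>. The bound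
  \<open>card J \<le> N powr \<alpha>\<close> is an inequality because side lengths of blocks are
  rounded down.\<close>

lemma moderate_deviation_upper_bound:
  assumes sq: "integrable M (\<lambda>\<omega>. (X0 \<omega>)\<^sup>2)" and mean: "expectation X0 = 0"
    and var: "expectation (\<lambda>\<omega>. (X0 \<omega>)\<^sup>2) \<le> s" and "s > 0" "c > 0" "\<alpha> > 0" "p > 0" "\<theta> > 0"
    and mom: "integrable M (\<lambda>\<omega>. \<bar>X0 \<omega>\<bar> powr p)"
    and \<theta>1: "\<theta> < \<alpha> * p / 2 - \<alpha>" and \<theta>2: "\<theta> < c\<^sup>2 / s"
  shows "\<exists>C. \<forall>J N. finite J \<longrightarrow> J \<subseteq> I \<longrightarrow> 1 \<le> N \<longrightarrow> real (card J) \<le> N powr \<alpha> \<longrightarrow>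
     prob {\<omega>\<in>space M. (\<Sum>j\<in>J. X j \<omega>) > c * sqrt (2 * N powr \<alpha> * ln N)} \<le> C * N powr (- \<theta>)"
proof -
  \<comment> \<open>The truncation level will satisfy \<open>h * b = \<eta>\<close>, so truncation
    inflates \<open>s\<close> to \<open>s * exp \<eta> = c\<^sup>2 / \<theta>\<close>, exactly what
    the gap between \<open>\<theta>\<close> and \<open>c\<^sup>2 / s\<close> allows.\<close>
  define \<eta> where "\<eta> = ln (c\<^sup>2 / (s * \<theta>))"
  have e\<eta>: "exp \<eta> = c\<^sup>2 / (s * \<theta>)" using assms by (simp add: \<eta>_def)
  have "\<theta> * s < c\<^sup>2" using \<theta>2 \<open>s > 0\<close> by (simp add: pos_less_divide_eq)
  then have "\<eta> > 0" using assms by (simp add: \<eta>_def mult.commute)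
  \<comment> \<open>The minimiser of \<open>- 2 * t * c + t\<^sup>2 * s * exp \<eta>\<close>, the
    Chernoff exponent per unit of \<open>ln N\<close>; the minimum is
    \<open>- t * c = - \<theta>\<close>.\<close>
  define t where "t = c / (s * exp \<eta>)"
  have "t > 0" using assms by (simp add: t_def)
  define mp where "mp = expectation (\<lambda>\<omega>. \<bar>X0 \<omega>\<bar> powr p)"
  have "mp \<ge> 0" by (simp add: mp_def)
  \<comment> \<open>Chosen so that
    \<open>(\<epsilon> - \<alpha>) * (p / 2) = - \<alpha> - \<theta>\<close>: the logarithm in the
    truncation level may cost a factor \<open>N powr \<epsilon>\<close>.\<close>
  define \<epsilon> where "\<epsilon> = (\<alpha> * p / 2 - \<alpha> - \<theta>) / (p / 2)"
  have "\<epsilon> > 0" using \<theta>1 \<open>p > 0\<close> by (simp add: \<epsilon>_def)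
  \<comment> \<open>The first summand serves the truncation term; the 1 serves the Chernoff term and
    makes the case \<open>N = 1\<close> trivial.\<close>
  define C where "C = mp * (t / \<eta>) powr p * (2 / \<epsilon>) powr (p / 2) + 1"
  have C1: "C \<ge> 1" using \<open>mp \<ge> 0\<close> by (simp add: C_def)
  show ?thesis
  proof (intro exI[of _ C] allI impI)
    fix J and N :: real assume J: "finite J" "J \<subseteq> I" and N: "1 \<le> N" "real (card J) \<le> N powr \<alpha>"
    show "prob {\<omega>\<in>space M. (\<Sum>j\<in>J. X j \<omega>) > c * sqrt (2 * N powr \<alpha> * ln N)} \<le> C * N powr (- \<theta>)"
    proof (cases "N = 1")
      case True
      then show ?thesis using C1 by (simp add: order_trans[OF prob_le_1])
    next
      case False
      define L where "L = ln N"
      have "N > 1" "L > 0" using False N by (auto simp: L_def)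
      define K where "K = N powr \<alpha>"
      have "K > 0" using \<open>N > 1\<close> by (simp add: K_def)
      define h where "h = t * sqrt (2 * L / K)"
      have "h > 0" using \<open>t > 0\<close> \<open>L > 0\<close> \<open>K > 0\<close> by (simp add: h_def)
      define b where "b = \<eta> / h"
      have "b > 0" using \<open>\<eta> > 0\<close> \<open>h > 0\<close> by (simp add: b_def)
      have hb: "h * b = \<eta>" using \<open>h > 0\<close> by (simp add: b_def)
      let ?y = "c * sqrt (2 * K * L)"
      have "sqrt (2 * L / K) * sqrt (2 * K * L) = sqrt ((2 * L)\<^sup>2)"
        unfolding real_sqrt_mult[symmetric] using \<open>K > 0\<close> by (simp add: power2_eq_square)
      also have "\<dots> = 2 * L" using \<open>L > 0\<close> by (subst real_sqrt_abs) simp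
      finally have hy: "h * ?y = 2 * t * c * L"
        by (simp add: h_def mult_ac)
      have h2: "h\<^sup>2 = t\<^sup>2 * (2 * L / K)" using \<open>L > 0\<close> \<open>K > 0\<close> by (simp add: h_def power_mult_distrib)
      have "card J * (h\<^sup>2 * s * exp \<eta> / 2) \<le> K * (h\<^sup>2 * s * exp \<eta> / 2)"
        using N \<open>s > 0\<close> by (intro mult_right_mono) (auto simp: K_def)
      also have "\<dots> = t * (t * s * exp \<eta>) * L"
        unfolding h2 using \<open>K > 0\<close> by (simp add: power2_eq_square)
      also have "t * s * exp \<eta> = c" using \<open>s > 0\<close> by (simp add: t_def)
      finally have "- h * ?y + card J * (h\<^sup>2 * s * exp (h * b) / 2) \<le> - (t * c * L)"
        using hy unfolding hb by linarith
      also have "t * c = \<theta>" using assms by (simp add: t_def e\<eta> power2_eq_square)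
      finally have ex: "exp (- h * ?y + card J * (h\<^sup>2 * s * exp (h * b) / 2)) \<le> N powr (- \<theta>)"
        using \<open>N > 1\<close> by (simp add: powr_def L_def)
      have "prob {\<omega>\<in>space M. X0 \<omega> > b} \<le> prob {\<omega>\<in>space M. b powr p \<le> \<bar>X0 \<omega>\<bar> powr p}"
        using \<open>b > 0\<close> \<open>p > 0\<close> by (intro finite_measure_mono) (auto intro!: powr_mono2)
      also have "\<dots> \<le> mp / b powr p"
        unfolding mp_def using mom \<open>b > 0\<close>
        by (intro integral_Markov_inequality_measure[where A="{}"]) auto
      also have "\<dots> = mp * (t / \<eta>) powr p * (2 * L / K) powr (p / 2)"
      proof -
        have "1 / b = t / \<eta> * (2 * L / K) powr (1 / 2)"
          using \<open>L > 0\<close> \<open>K > 0\<close> by (simp add: b_def h_def powr_half_sqrt)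
        then have "(1 / b) powr p = (t / \<eta>) powr p * (2 * L / K) powr (p / 2)"
          using \<open>L > 0\<close> \<open>K > 0\<close> \<open>t > 0\<close> \<open>\<eta> > 0\<close> by (simp only: powr_mult powr_powr) simp
        moreover have "mp / b powr p = mp * (1 / b) powr p" using \<open>b > 0\<close> by (simp add: powr_divide)
        ultimately show ?thesis by simp
      qed
      finally have P: "prob {\<omega>\<in>space M. X0 \<omega> > b} \<le> mp * (t / \<eta>) powr p * (2 * L / K) powr (p / 2)" .
      have "L \<le> N powr \<epsilon> / \<epsilon>" unfolding L_def using \<open>N > 1\<close> \<open>\<epsilon> > 0\<close> by (intro ln_powr_bound) auto
      then have "(2 * L / K) powr (p / 2) \<le> (2 * (N powr \<epsilon> / \<epsilon>) / K) powr (p / 2)"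
        using \<open>L > 0\<close> \<open>K > 0\<close> \<open>p > 0\<close> by (intro powr_mono2 divide_right_mono mult_left_mono) auto
      also have "2 * (N powr \<epsilon> / \<epsilon>) / K = 2 / \<epsilon> * N powr (\<epsilon> - \<alpha>)"
        by (simp add: K_def powr_diff)
      also have "(2 / \<epsilon> * N powr (\<epsilon> - \<alpha>)) powr (p / 2) = (2 / \<epsilon>) powr (p / 2) * N powr ((\<epsilon> - \<alpha>) * (p / 2))"
        using \<open>\<epsilon> > 0\<close> by (simp only: powr_mult powr_powr)
      also have "(\<epsilon> - \<alpha>) * (p / 2) = - \<alpha> - \<theta>" using \<open>p > 0\<close> by (simp add: \<epsilon>_def field_simps)
      finally have LK: "(2 * L / K) powr (p / 2) \<le> (2 / \<epsilon>) powr (p / 2) * N powr (- \<alpha> - \<theta>)" .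
      have "card J * prob {\<omega>\<in>space M. X0 \<omega> > b} \<le> K * (mp * (t / \<eta>) powr p * ((2 / \<epsilon>) powr (p / 2) * N powr (- \<alpha> - \<theta>)))"
        using N P LK \<open>mp \<ge> 0\<close>
        by (intro mult_mono order_trans[OF P] mult_left_mono) (auto simp: K_def)
      also have "\<dots> = mp * (t / \<eta>) powr p * (2 / \<epsilon>) powr (p / 2) * (K * N powr (- \<alpha> - \<theta>))"
        by simp
      also have "K * N powr (- \<alpha> - \<theta>) = N powr (- \<theta>)"
        by (simp add: K_def powr_add[symmetric])
      finally have t1: "card J * prob {\<omega>\<in>space M. X0 \<omega> > b} \<le> mp * (t / \<eta>) powr p * (2 / \<epsilon>) powr (p / 2) * N powr (- \<theta>)" .
      have "prob {\<omega>\<in>space M. (\<Sum>j\<in>J. X j \<omega>) > ?y} \<le>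
        card J * prob {\<omega>\<in>space M. X0 \<omega> > b} + exp (- h * ?y + card J * (h\<^sup>2 * s * exp (h * b) / 2))"
        using J \<open>h > 0\<close> \<open>b > 0\<close> by (intro prob_sum_gt_le sq mean var)
      also have "\<dots> \<le> C * N powr (- \<theta>)" using t1 ex by (simp add: C_def algebra_simps)
      finally show ?thesis by (simp add: K_def L_def)
    qed
  qed
qed

end

section \<open>Borel-Cantelli lemmas\<close>

text \<open>First Borel-Cantelli lemma transported along \<open>to_nat\<close>. Bounding all finite
  partial sums avoids choosing an order of summation on the multi-indices.\<close>

lemma (in prob_space) finitely_many_events:
  fixes A :: "'i::countable \<Rightarrow> 'a set"
  assumes ev: "\<And>k. k \<in> S \<Longrightarrow> A k \<in> events"
    and B: "\<And>F. finite F \<Longrightarrow> F \<subseteq> S \<Longrightarrow> (\<Sum>k\<in>F. prob (A k)) \<le> B"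
  shows "AE \<omega> in M. finite {k\<in>S. \<omega> \<in> A k}"
proof -
  define A' where "A' m = (if m \<in> to_nat ` S then A (from_nat m) else {})" for m
  have A': "A' m \<in> events" for m using ev by (auto simp: A'_def)
  have "summable (\<lambda>m. prob (A' m))"
  proof (rule summableI_nonneg_bounded)
    fix n
    let ?G = "{..<n} \<inter> to_nat ` S"
    have "(\<Sum>m<n. prob (A' m)) = (\<Sum>m\<in>?G. prob (A (from_nat m)))"
      by (rule sum.mono_neutral_cong_right) (auto simp: A'_def)
    also have "\<dots> = (\<Sum>k\<in>from_nat ` ?G. prob (A k))"
      by (subst sum.reindex) (auto intro!: inj_onI)
    also have "\<dots> \<le> B" by (rule B) auto
    finally show "(\<Sum>m<n. prob (A' m)) \<le> B" .
  qed auto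
  then have "AE \<omega> in M. eventually (\<lambda>m. \<omega> \<in> space M - A' m) sequentially"
    using A' by (intro borel_cantelli_AE1) (auto simp: emeasure_eq_measure)
  then show ?thesis
  proof (rule AE_mp, intro AE_I2 impI)
    fix \<omega> assume "eventually (\<lambda>m. \<omega> \<in> space M - A' m) sequentially"
    then obtain m0 where m0: "\<And>m. m \<ge> m0 \<Longrightarrow> \<omega> \<notin> A' m" by (auto simp: eventually_sequentially)
    have "to_nat ` {k\<in>S. \<omega> \<in> A k} \<subseteq> {..<m0}"
    proof clarify
      fix k assume "k \<in> S" "\<omega> \<in> A k"
      then have "\<omega> \<in> A' (to_nat k)" by (simp add: A'_def)
      then show "to_nat k < m0" using m0 by (meson not_le)
    qed
    then have "finite (to_nat ` {k\<in>S. \<omega> \<in> A k})" by (rule finite_subset) simp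
    then show "finite {k\<in>S. \<omega> \<in> A k}" by (rule finite_imageD) (auto intro!: inj_onI)
  qed
qed

text \<open>Without exceedance among the first \<open>n\<close> variables the probability is a
  product of factors \<open>1 - p \<le> exp (- p)\<close>, which tends to 0 along a divergent
  series. One exceedance suffices, as the lemma is applied to indices beyond an arbitrary
  bound.\<close>

lemma (in prob_space) AE_exists_exceedance:
  fixes Y :: "nat \<Rightarrow> 'a \<Rightarrow> real"
  assumes ind: "indep_vars (\<lambda>_. borel) Y UNIV"
    and div: "\<not> summable (\<lambda>k. prob {\<omega>\<in>space M. Y k \<omega> > y k})"
  shows "AE \<omega> in M. \<exists>k. Y k \<omega> > y k"
proof -
  let ?p = "\<lambda>k. prob {\<omega>\<in>space M. Y k \<omega> > y k}"
  have [measurable]: "Y k \<in> borel_measurable M" for k using ind by (auto simp: indep_vars_def)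
  let ?E = "{\<omega>\<in>space M. \<forall>k. Y k \<omega> \<le> y k}"
  have bound: "prob ?E \<le> exp (- (\<Sum>k<n. ?p k))" if "n > 0" for n
  proof -
    have "prob ?E \<le> prob (\<Inter>k\<in>{..<n}. Y k -` {..y k} \<inter> space M)"
      using that by (intro finite_measure_mono) auto
    also have "\<dots> = (\<Prod>k<n. prob (Y k -` {..y k} \<inter> space M))"
      using that by (intro indep_varsD[OF ind]) auto
    also have "\<dots> = (\<Prod>k<n. 1 - ?p k)"
    proof (rule prod.cong[OF refl])
      fix k
      have "prob (space M - {\<omega>\<in>space M. Y k \<omega> > y k}) = 1 - ?p k" by (rule prob_compl) measurable
      moreover have "space M - {\<omega>\<in>space M. Y k \<omega> > y k} = Y k -` {..y k} \<inter> space M" by auto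
      ultimately show "prob (Y k -` {..y k} \<inter> space M) = 1 - ?p k" by simp
    qed
    also have "\<dots> \<le> (\<Prod>k<n. exp (- ?p k))"
      using exp_ge_add_one_self[of "- ?p k" for k] by (intro prod_mono) auto
    also have "\<dots> = exp (- (\<Sum>k<n. ?p k))" by (simp add: exp_sum[symmetric] sum_negf)
    finally show ?thesis .
  qed
  have "prob ?E = 0"
  \<comment> \<open>A positive probability of no exceedance would bound all partial sums by minus
    its logarithm.\<close>
  proof (rule ccontr)
    assume "prob ?E \<noteq> 0"
    then have pos: "prob ?E > 0" by (simp add: zero_less_measure_iff)
    have "summable ?p"
    proof (rule summableI_nonneg_bounded)
      fix n
      show "(\<Sum>k<n. ?p k) \<le> max 0 (- ln (prob ?E))"
      proof (cases "n > 0")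
        case True
        have "ln (prob ?E) \<le> - (\<Sum>k<n. ?p k)" 
          using ln_mono[OF bound[OF True] pos] by simp
        then show ?thesis by linarith
      qed simp
    qed simp
    then show False using div by simp
  qed
  then have "AE \<omega> in M. \<not> (\<forall>k. Y k \<omega> \<le> y k)"
    by (subst AE_iff_measurable[OF _ refl]) (auto simp: emeasure_eq_measure)
  then show ?thesis by (simp add: not_le)
qed

section \<open>Multi-indices and the set \<open>\<Lambda>\<^sup>*\<close>\<close>

text \<open>The finite set \<open>F\<close> lies in a cube over the finitely many coordinate values
  that occur, and over a cube the sum of products factorises.\<close>

lemma sum_prod_le_power:
  fixes f :: "'b \<Rightarrow> real" and F :: "('d::finite \<Rightarrow> 'b) set"
  assumes f: "\<And>m. f m \<ge> 0" and B: "\<And>G. finite G \<Longrightarrow> G \<subseteq> A \<Longrightarrow> sum f G \<le> B"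
    and F: "finite F" "\<And>n i. n \<in> F \<Longrightarrow> n i \<in> A"
  shows "(\<Sum>n\<in>F. \<Prod>i\<in>UNIV. f (n i)) \<le> B ^ CARD('d)"
proof -
  define G where "G = (\<Union>n\<in>F. range n)"
  have G: "finite G" "G \<subseteq> A" using F by (auto simp: G_def)
  have "(\<Sum>n\<in>F. \<Prod>i\<in>UNIV. f (n i)) \<le> (\<Sum>n\<in>PiE (UNIV::'d set) (\<lambda>_. G). \<Prod>i\<in>UNIV. f (n i))"
  proof (rule sum_mono2)
    show "F \<subseteq> PiE UNIV (\<lambda>_. G)" by (auto simp: G_def)
  qed (use G f in \<open>auto intro!: finite_PiE prod_nonneg\<close>)
  also have "\<dots> = (\<Prod>i\<in>(UNIV::'d set). sum f G)"
    using G by (subst prod_sum_PiE) auto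
  also have "\<dots> \<le> B ^ CARD('d)"
    using B[OF G] f by (simp add: power_mono sum_nonneg)
  finally show ?thesis .
qed

text \<open>There are finitely many coordinates, so their separate thresholds can be replaced by the
  maximum.\<close>

lemma eventually_multi_at_top_in:
  "eventually P (multi_at_top_in L) \<longleftrightarrow> (\<exists>N. \<forall>n. (\<forall>i. N \<le> n i \<and> n i \<in> L) \<longrightarrow> P n)"
  (is "?L \<longleftrightarrow> ?R")
proof
  assume ?L
  then obtain Q where Q: "\<And>i. \<exists>N::nat. \<forall>n. n i \<ge> N \<longrightarrow> Q i n" "\<And>n. (\<forall>i. Q i n) \<Longrightarrow> (\<forall>i. n i \<in> L) \<longrightarrow> P n"
    unfolding multi_at_top_in_def multi_at_top_def eventually_inf_principal
    by (subst (asm) eventually_INF_finite) (auto simp: eventually_filtercomap_at_top_linorder)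
  then obtain N where N: "\<And>i n. n i \<ge> N i \<Longrightarrow> Q i n" by metis
  show ?R
    using Q(2) N by (intro exI[of _ "Max (range N)"]) (auto intro: order_trans[OF Max_ge])
next
  assume ?R
  then obtain N where N: "\<And>n. (\<forall>i. N \<le> n i \<and> n i \<in> L) \<Longrightarrow> P n" by auto
  show ?L
    unfolding multi_at_top_in_def multi_at_top_def eventually_inf_principal
    using N by (subst eventually_INF_finite)
      (auto simp: eventually_filtercomap_at_top_linorder intro!: exI[of _ "\<lambda>i n. N \<le> n i"])
qed

lemma box_eq_PiE: "{j. \<forall>i. n i < j i \<and> j i \<le> n i + k i} = PiE UNIV (\<lambda>i. {n i<..n i + k i})"
  for n k :: "'d::finite \<Rightarrow> nat"
  by (auto simp: PiE_iff)

lemma finite_box: "finite {j. \<forall>i. n i < j i \<and> j i \<le> n i + k i}"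
  for n k :: "'d::finite \<Rightarrow> nat"
  unfolding box_eq_PiE by (intro finite_PiE) auto

lemma card_box: "card {j. \<forall>i. n i < j i \<and> j i \<le> n i + k i} = (\<Prod>i\<in>UNIV. k i)"
  for n k :: "'d::finite \<Rightarrow> nat"
  unfolding box_eq_PiE by (subst card_PiE) auto

lemma box_subset_Zplus: "{j. \<forall>i. n i < j i \<and> j i \<le> n i + k i} \<subseteq> Zplus"
  by (auto simp: Zplus_def Suc_le_eq intro: le_less_trans[OF zero_le])

lemma real_mabs_powr: "real (mabs n) powr a = (\<Prod>i\<in>UNIV. real (n i) powr a)"
  by (simp add: mabs_def prod_powr_distrib)

lemma mabs_ge: "(\<And>i. n i \<ge> 1) \<Longrightarrow> n i \<le> mabs n"
proof -
  assume *: "\<And>i. n i \<ge> 1"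
  have "mabs n = n i * (\<Prod>j\<in>UNIV-{i}. n j)" unfolding mabs_def by (rule prod.remove) auto
  moreover have "(\<Prod>j\<in>UNIV-{i}. n j) \<ge> 1" using * by (intro prod_ge_1) auto
  ultimately show ?thesis by simp
qed

section \<open>The enumeration of \<open>Lambda_star\<close> by integer parts of powers\<close>

definition floor_powr :: "real \<Rightarrow> nat \<Rightarrow> nat" where
  "floor_powr g i = nat \<lfloor>real i powr g\<rfloor>"

lemma Lambda_star_eq: "Lambda_star a b = floor_powr (b / (1 - a)) ` {1..}"
  by (auto simp: Lambda_star_def floor_powr_def)

lemma floor_powr_le: "real (floor_powr g i) \<le> real i powr g"
  by (simp add: floor_powr_def)

lemma half_le_nat_floor: "x \<ge> 1 \<Longrightarrow> x / 2 \<le> real (nat \<lfloor>x\<rfloor>)"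
proof -
  assume "x \<ge> 1"
  then have "\<lfloor>x\<rfloor> \<ge> 1" by simp
  moreover have "x < of_int \<lfloor>x\<rfloor> + 1" by linarith
  moreover have "real (nat \<lfloor>x\<rfloor>) = of_int \<lfloor>x\<rfloor>" using \<open>x \<ge> 1\<close> by simp
  ultimately show ?thesis by linarith
qed

lemma floor_powr_ge: "i \<ge> 1 \<Longrightarrow> g \<ge> 0 \<Longrightarrow> real i powr g / 2 \<le> real (floor_powr g i)"
  unfolding floor_powr_def by (rule half_le_nat_floor) (simp add: ge_one_powr_ge_zero)

lemma floor_powr_ge_1: "i \<ge> 1 \<Longrightarrow> g \<ge> 0 \<Longrightarrow> floor_powr g i \<ge> 1"
  using ge_one_powr_ge_zero[of "real i" g] by (simp add: floor_powr_def le_nat_iff)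

lemma floor_powr_mono: "i \<le> j \<Longrightarrow> g \<ge> 0 \<Longrightarrow> floor_powr g i \<le> floor_powr g j"
  unfolding floor_powr_def by (intro nat_mono floor_mono powr_mono2) auto

lemma floor_powr_unbounded:
  assumes "g > 0" shows "\<exists>k0. \<forall>k\<ge>k0. N \<le> floor_powr g k"
proof -
  have "filterlim (\<lambda>k::nat. real k powr g) at_top at_top"
    using assms by real_asymp
  then have "eventually (\<lambda>k. real k powr g \<ge> real N) at_top"
    by (simp add: filterlim_at_top)
  then show ?thesis
    by (auto simp: eventually_sequentially floor_powr_def le_nat_iff le_floor_iff)
qed

text \<open>Since \<open>g = 1 + g * a + (b - 1)\<close>, the increments of \<open>k powr g\<close>
  have order \<open>k powr (g * a + (b - 1))\<close>, while the side length to be accommodated is at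
  most \<open>k powr (g * a)\<close>. This is where \<open>b > 1\<close> separates the
  blocks.\<close>

lemma floor_powr_gap:
  assumes "0 < a" "a < 1" "1 < b"
  defines "g \<equiv> b / (1 - a)"
  shows "\<exists>k0. \<forall>k\<ge>k0. floor_powr g k + nat \<lfloor>real (floor_powr g k) powr a\<rfloor> \<le> floor_powr g (Suc k)"
proof -
  have "g > 0" using assms by (simp add: g_def)
  define \<theta> where "\<theta> = g * a"
  have g: "g = 1 + \<theta> + (b - 1)" using assms by (simp add: g_def \<theta>_def field_simps)
  have "\<theta> > 0" "b - 1 > 0" using assms by (auto simp: \<theta>_def g_def)
  \<comment> \<open>The exponent is written out so that its excess \<open>b - 1\<close> is a visibly
    positive parameter; the summand 1 absorbs the rounding of the next element.\<close>
  then have "\<forall>\<^sub>F x::real in at_top. (x+1) powr (1+\<theta>+(b-1)) - x powr (1+\<theta>+(b-1)) > x powr \<theta> + 1"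
    by real_asymp
  then have "\<forall>\<^sub>F x::real in at_top. (x+1) powr g - x powr g > x powr \<theta> + 1"
    by (simp only: g[symmetric])
  then have "\<forall>\<^sub>F k::nat in at_top. (real k+1) powr g - real k powr g > real k powr \<theta> + 1"
    by (rule eventually_compose_filterlim[OF _ filterlim_real_sequentially])
  then obtain k0 where k0: "\<And>k. k \<ge> k0 \<Longrightarrow> (real k+1) powr g - real k powr g > real k powr \<theta> + 1"
    by (auto simp: eventually_sequentially)
  show ?thesis
  proof (intro exI[of _ k0] allI impI)
    fix k assume "k \<ge> k0"
    have "real (floor_powr g k) powr a \<le> (real k powr g) powr a"
      using assms floor_powr_le by (intro powr_mono2) auto
    then have 1: "real (floor_powr g k) powr a \<le> real k powr \<theta>" by (simp add: powr_powr \<theta>_def)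
    have 2: "real (nat \<lfloor>real (floor_powr g k) powr a\<rfloor>) \<le> real (floor_powr g k) powr a" by simp
    have 3: "real (floor_powr g (Suc k)) > (real k + 1) powr g - 1" 
      unfolding floor_powr_def by (simp add: add.commute)
    have "real (floor_powr g k + nat \<lfloor>real (floor_powr g k) powr a\<rfloor>) < real (floor_powr g (Suc k))"
      using 1 2 3 k0[OF \<open>k \<ge> k0\<close>] floor_powr_le[of g k] unfolding of_nat_add by linarith
    then show "floor_powr g k + nat \<lfloor>real (floor_powr g k) powr a\<rfloor> \<le> floor_powr g (Suc k)" by linarith
  qed
qed

text \<open>Comparison with the series of \<open>i powr (- (g * \<theta>))\<close>, where
  \<open>g * \<theta> > 1\<close>. The factor \<open>2 powr \<theta>\<close> accounts for integer
  parts being at least half the power.\<close>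

lemma sum_Lambda_star_bounded:
  assumes "0 < a" "a < 1" "1 < b" and \<theta>: "(1 - a) / b < \<theta>"
  shows "\<exists>B. \<forall>G. finite G \<longrightarrow> G \<subseteq> Lambda_star a b \<longrightarrow> (\<Sum>m\<in>G. real m powr (- \<theta>)) \<le> B"
proof -
  define g where "g = b / (1 - a)"
  have "g > 0" using assms by (simp add: g_def)
  have "\<theta> > 0" using assms by (meson divide_pos_pos diff_gt_0_iff_gt less_trans zero_less_one)
  have g\<theta>: "g * \<theta> > 1" using assms by (simp add: g_def field_simps)
  let ?f = "\<lambda>i::nat. 2 powr \<theta> * real i powr (- (g * \<theta>))"
  have sm: "summable ?f" using g\<theta> by (intro summable_mult) (simp add: summable_real_powr_iff)
  show ?thesis
  proof (intro exI[of _ "suminf ?f"] allI impI)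
    fix G assume G: "finite G" "G \<subseteq> Lambda_star a b"
    then have "\<forall>m\<in>G. \<exists>i\<ge>1. m = floor_powr g i" by (auto simp: Lambda_star_eq g_def)
    \<comment> \<open>\<open>e\<close> picks one preimage of each \<open>m\<close>; it is injective
      because \<open>m\<close> is recovered from \<open>e m\<close>.\<close>
    then obtain e where e: "\<And>m. m \<in> G \<Longrightarrow> e m \<ge> 1 \<and> m = floor_powr g (e m)" by metis
    have "inj_on e G" using e by (metis inj_onI)
    have "(\<Sum>m\<in>G. real m powr (- \<theta>)) \<le> (\<Sum>m\<in>G. ?f (e m))"
    proof (rule sum_mono)
      fix m assume "m \<in> G"
      then have em: "e m \<ge> 1" "m = floor_powr g (e m)" using e by auto
      have "real m powr (- \<theta>) \<le> (real (e m) powr g / 2) powr (- \<theta>)"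
        using em floor_powr_ge[of "e m" g] \<open>g > 0\<close> \<open>\<theta> > 0\<close> by (intro powr_mono2') auto
      also have "\<dots> = ?f (e m)" by (simp add: powr_divide powr_powr powr_minus field_simps)
      finally show "real m powr (- \<theta>) \<le> ?f (e m)" .
    qed
    also have "\<dots> = sum ?f (e ` G)" using \<open>inj_on e G\<close> by (simp add: sum.reindex)
    also have "\<dots> \<le> suminf ?f" using sm G by (intro sum_le_suminf) auto
    finally show "(\<Sum>m\<in>G. real m powr (- \<theta>)) \<le> suminf ?f" .
  qed
qed

section \<open>Limit theorem for the block sums\<close>

text \<open>The exponent \<open>k\<close> may be negative, but \<open>x powr (q - p)\<close>
  eventually dominates any power of the logarithm. Below the threshold the integrand is bounded and
  the measure is finite.\<close>

lemma integrable_powr_of_log_weight: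
  fixes f :: "'a \<Rightarrow> real"
  assumes "finite_measure M" and [measurable]: "f \<in> borel_measurable M" and pq: "0 < p" "p < q"
    and int: "integrable M (\<lambda>\<omega>. \<bar>f \<omega>\<bar> powr q * logp \<bar>f \<omega>\<bar> powr k)"
  shows "integrable M (\<lambda>\<omega>. \<bar>f \<omega>\<bar> powr p)"
proof -
  interpret finite_measure M by fact
  have "\<forall>\<^sub>F x::real in at_top. x powr p \<le> x powr q * ln x powr k"
    using pq by real_asymp
  moreover have "\<forall>\<^sub>F x::real in at_top. ln x \<ge> 1" by real_asymp
  ultimately have "\<forall>\<^sub>F x::real in at_top. x powr p \<le> x powr q * logp x powr k"
    by eventually_elim (simp add: logp_def)
  then obtain A where A: "\<And>x. x \<ge> A \<Longrightarrow> x powr p \<le> x powr q * logp x powr k"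
    by (auto simp: eventually_at_top_linorder)
  have bd: "\<bar>x\<bar> powr p \<le> \<bar>A\<bar> powr p + \<bar>x\<bar> powr q * logp \<bar>x\<bar> powr k" for x :: real
  proof (cases "\<bar>x\<bar> \<ge> A")
    case True
    then show ?thesis using A[of "\<bar>x\<bar>"] by (simp add: add_increasing)
  next
    case False
    then have "\<bar>x\<bar> powr p \<le> \<bar>A\<bar> powr p" using pq by (intro powr_mono2) auto
    then show ?thesis by (simp add: add_increasing2)
  qed
  show ?thesis
    by (rule Bochner_Integration.integrable_bound[where f="\<lambda>\<omega>. \<bar>A\<bar> powr p + \<bar>f \<omega>\<bar> powr q * logp \<bar>f \<omega>\<bar> powr k"])
      (use int bd in \<open>auto simp: abs_of_nonneg add_nonneg_nonneg\<close>)
qed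

definition norming :: "real \<Rightarrow> ('d::finite \<Rightarrow> nat) \<Rightarrow> real" where
  "norming \<alpha> n = sqrt (2 * real (mabs n) powr \<alpha> * ln (real (mabs n)))"

lemma mabs_ge_1: "(\<And>i. n i \<ge> 1) \<Longrightarrow> mabs n \<ge> 1"
  unfolding mabs_def by (intro prod_ge_1) auto

lemma norming_nonneg: "(\<And>i. n i \<ge> 1) \<Longrightarrow> norming \<alpha> n \<ge> 0"
  using mabs_ge_1[of n] by (simp add: norming_def)

lemma card_mpow_box_le:
  "real (card {j. \<forall>i. n i < j i \<and> j i \<le> n i + mpow n \<alpha> i}) \<le> real (mabs n) powr \<alpha>"
  unfolding card_box real_mabs_powr of_nat_prod by (intro prod_mono) (auto simp: mpow_def)

lemma Lambda_star_ge_1: "m \<in> Lambda_star a b \<Longrightarrow> 0 < a \<Longrightarrow> a < 1 \<Longrightarrow> 1 < b \<Longrightarrow> m \<ge> 1"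
  by (auto simp: Lambda_star_eq simp del: One_nat_def intro!: floor_powr_ge_1)

section \<open>Upper bound for the upper limit\<close>

text \<open>Bundled so that every result can be used both for the field and for its negative. The
  degenerate case \<open>\<sigma> = 0\<close> is included.\<close>

locale iid_field = iid_family M X Zplus X0
  for M :: "'a measure" and X :: "('d::finite \<Rightarrow> nat) \<Rightarrow> 'a \<Rightarrow> real" and X0 +
  fixes \<alpha> \<beta> \<sigma> :: real
  assumes \<alpha>: "0 < \<alpha>" "\<alpha> < 1" and \<beta>: "1 < \<beta>" and \<sigma>: "0 \<le> \<sigma>"
    and sq: "integrable M (\<lambda>\<omega>. (X0 \<omega>)\<^sup>2)" and mean: "expectation X0 = 0"
    and var: "variance X0 = \<sigma>\<^sup>2"
begin

abbreviation "T n \<equiv> Tsum X n (mpow n \<alpha>)"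

lemma T_measurable [measurable]: "T n \<in> borel_measurable M"
  unfolding Tsum_def[abs_def] by (rule sum_measurable) (rule box_subset_Zplus)

text \<open>The moderate deviation bound with \<open>N\<close> equal to \<open>mabs n\<close>. The
  conditions on \<open>p\<close> and \<open>c\<close> leave room for an exponent
  \<open>\<theta>\<close> strictly above \<open>(1 - \<alpha>) / \<beta>\<close>.\<close>

lemma prob_T_le:
  assumes p: "\<alpha> * p / 2 - \<alpha> > (1 - \<alpha>) / \<beta>" and mom: "integrable M (\<lambda>\<omega>. \<bar>X0 \<omega>\<bar> powr p)"
    and c: "\<sigma> * sqrt ((1 - \<alpha>) / \<beta>) < c"
  shows "\<exists>C \<theta>. (1 - \<alpha>) / \<beta> < \<theta> \<and> (\<forall>n\<in>Zplus. prob {\<omega>\<in>space M. T n \<omega> > c * norming \<alpha> n} \<le> C * real (mabs n) powr (- \<theta>))"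
proof -
  define \<tau> where "\<tau> = (1 - \<alpha>) / \<beta>"
  have "\<tau> > 0" using \<alpha> \<beta> by (simp add: \<tau>_def)
  have "0 \<le> \<sigma> * sqrt \<tau>" using \<sigma> \<open>\<tau> > 0\<close> by simp
  then have "c > 0" using c by (simp add: \<tau>_def)
  have "(\<sigma> * sqrt \<tau>)\<^sup>2 < c\<^sup>2" using c \<sigma> \<open>\<tau> > 0\<close> by (intro power_strict_mono) (auto simp: \<tau>_def[symmetric])
  then have "\<sigma>\<^sup>2 * \<tau> < c\<^sup>2" using \<open>\<tau> > 0\<close> by (simp add: power_mult_distrib)
  then have "\<sigma>\<^sup>2 < c\<^sup>2 / \<tau>" using \<open>\<tau> > 0\<close> by (simp add: pos_less_divide_eq)
  \<comment> \<open>A value strictly above the variance is positive even when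
    \<open>\<sigma> = 0\<close>.\<close>
  then obtain s where s: "\<sigma>\<^sup>2 < s" "s < c\<^sup>2 / \<tau>" using dense by blast
  have "s > 0" using s by (meson le_less_trans zero_le_power2)
  have "\<tau> < c\<^sup>2 / s" using s \<open>s > 0\<close> \<open>\<tau> > 0\<close> by (simp add: field_simps)
  then have "\<tau> < min (c\<^sup>2 / s) (\<alpha> * p / 2 - \<alpha>)" using p by (simp add: \<tau>_def)
  then obtain \<theta> where \<theta>: "\<tau> < \<theta>" "\<theta> < c\<^sup>2 / s" "\<theta> < \<alpha> * p / 2 - \<alpha>" using dense by (metis min_less_iff_conj)
  have "\<theta> > 0" using \<theta> \<open>\<tau> > 0\<close> by linarith
  have "\<alpha> * p / 2 > 0" using \<theta> \<alpha> \<open>\<theta> > 0\<close> by linarith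
  then have "p > 0" using \<alpha> by (simp add: zero_less_mult_iff)
  have v: "expectation (\<lambda>\<omega>. (X0 \<omega>)\<^sup>2) \<le> s" using var mean s by simp
  obtain C where C: "\<And>J N. finite J \<Longrightarrow> J \<subseteq> Zplus \<Longrightarrow> 1 \<le> N \<Longrightarrow> real (card J) \<le> N powr \<alpha> \<Longrightarrow>
     prob {\<omega>\<in>space M. (\<Sum>j\<in>J. X j \<omega>) > c * sqrt (2 * N powr \<alpha> * ln N)} \<le> C * N powr (- \<theta>)"
    using moderate_deviation_upper_bound[OF sq mean v \<open>s > 0\<close> \<open>c > 0\<close> \<alpha>(1) \<open>p > 0\<close> \<open>\<theta> > 0\<close> mom \<theta>(3) \<theta>(2)] by blast
  show ?thesis
  proof (rule exI[of _ C], rule exI[of _ \<theta>], intro conjI ballI)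
    show "(1 - \<alpha>) / \<beta> < \<theta>" using \<theta> by (simp add: \<tau>_def)
    fix n :: "'d \<Rightarrow> nat" assume "n \<in> Zplus"
    then have "1 \<le> real (mabs n)" using mabs_ge_1[of n] by (simp add: Zplus_def)
    from C[OF finite_box box_subset_Zplus this card_mpow_box_le]
    show "prob {\<omega>\<in>space M. T n \<omega> > c * norming \<alpha> n} \<le> C * real (mabs n) powr (- \<theta>)"
      by (simp add: Tsum_def norming_def)
  qed
qed

text \<open>The bounds on the probabilities factorise over the coordinates and each factor has
  bounded sums over \<open>Lambda_star\<close>, so almost surely only finitely many indices are
  exceptional.\<close>

lemma AE_eventually_T_le:
  assumes p: "\<alpha> * p / 2 - \<alpha> > (1 - \<alpha>) / \<beta>" and mom: "integrable M (\<lambda>\<omega>. \<bar>X0 \<omega>\<bar> powr p)"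
    and c: "\<sigma> * sqrt ((1 - \<alpha>) / \<beta>) < c"
  shows "AE \<omega> in M. eventually (\<lambda>n. T n \<omega> / norming \<alpha> n \<le> c) (multi_at_top_in (Lambda_star \<alpha> \<beta>))"
proof -
  obtain C \<theta> where \<theta>: "(1 - \<alpha>) / \<beta> < \<theta>"
    and C: "\<And>n. n \<in> Zplus \<Longrightarrow> prob {\<omega>\<in>space M. T n \<omega> > c * norming \<alpha> n} \<le> C * real (mabs n) powr (- \<theta>)"
    using prob_T_le[OF assms] by blast
  obtain B where B: "\<And>G. finite G \<Longrightarrow> G \<subseteq> Lambda_star \<alpha> \<beta> \<Longrightarrow> (\<Sum>m\<in>G. real m powr (- \<theta>)) \<le> B"
    using sum_Lambda_star_bounded[OF \<alpha> \<beta> \<theta>] by blast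
  let ?S = "{n::'d \<Rightarrow> nat. \<forall>i. n i \<in> Lambda_star \<alpha> \<beta>}"
  have SZ: "?S \<subseteq> Zplus" using Lambda_star_ge_1[OF _ \<alpha> \<beta>] by (auto simp: Zplus_def)
  have "(\<lambda>_. 1) \<in> Zplus" by (simp add: Zplus_def)
  \<comment> \<open>At the index with all coordinates 1 the bound reads
    \<open>0 \<le> C\<close>.\<close>
  from order_trans[OF measure_nonneg C[OF this]] have "C \<ge> 0" by (simp add: mabs_def)
  have "0 \<le> \<sigma> * sqrt ((1 - \<alpha>) / \<beta>)" using \<alpha> \<beta> \<sigma> by simp
  then have "c > 0" using c by linarith
  have "AE \<omega> in M. finite {n\<in>?S. \<omega> \<in> {\<omega>\<in>space M. T n \<omega> > c * norming \<alpha> n}}"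
  proof (rule finitely_many_events)
    fix F :: "('d \<Rightarrow> nat) set" assume F: "finite F" "F \<subseteq> ?S"
    have "(\<Sum>n\<in>F. prob {\<omega>\<in>space M. T n \<omega> > c * norming \<alpha> n}) \<le> (\<Sum>n\<in>F. C * (\<Prod>i\<in>UNIV. real (n i) powr (- \<theta>)))"
    proof (rule sum_mono)
      fix n assume "n \<in> F"
      then have "n \<in> Zplus" using F SZ by blast
      then show "prob {\<omega>\<in>space M. T n \<omega> > c * norming \<alpha> n} \<le> C * (\<Prod>i\<in>UNIV. real (n i) powr (- \<theta>))"
        using C by (simp add: real_mabs_powr)
    qed
    also have "\<dots> = C * (\<Sum>n\<in>F. \<Prod>i\<in>UNIV. real (n i) powr (- \<theta>))" by (simp add: sum_distrib_left)
    also have "\<dots> \<le> C * B ^ CARD('d)"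
      using F B \<open>C \<ge> 0\<close> by (intro mult_left_mono sum_prod_le_power[where A="Lambda_star \<alpha> \<beta>"]) auto
    finally show "(\<Sum>n\<in>F. prob {\<omega>\<in>space M. T n \<omega> > c * norming \<alpha> n}) \<le> C * B ^ CARD('d)" .
  qed measurable
  then show ?thesis
  proof (rule AE_mp, intro AE_I2 impI)
    fix \<omega> assume "\<omega> \<in> space M" and "finite {n\<in>?S. \<omega> \<in> {\<omega>\<in>space M. T n \<omega> > c * norming \<alpha> n}}"
    then have fin: "finite {n\<in>?S. T n \<omega> > c * norming \<alpha> n}" (is "finite ?E") by simp
    \<comment> \<open>\<open>undefined\<close> names an arbitrary coordinate: exceeding the maximum
      of that coordinate over the exceptional indices is enough. Inserting 0 covers the case of no
      exceptional index.\<close>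
    define N where "N = Suc (Max (insert 0 ((\<lambda>n. n undefined) ` ?E)))"
    show "eventually (\<lambda>n. T n \<omega> / norming \<alpha> n \<le> c) (multi_at_top_in (Lambda_star \<alpha> \<beta>))"
      unfolding eventually_multi_at_top_in
    proof (intro exI[of _ N] allI impI)
      fix n :: "'d \<Rightarrow> nat" assume n: "\<forall>i. N \<le> n i \<and> n i \<in> Lambda_star \<alpha> \<beta>"
      have "n \<notin> ?E"
      proof
        assume "n \<in> ?E"
        then have "n undefined \<le> Max (insert 0 ((\<lambda>n. n undefined) ` ?E))"
          using fin by (intro Max_ge) auto
        then show False using n[THEN spec, of undefined] by (simp add: N_def)
      qed
      then have le: "T n \<omega> \<le> c * norming \<alpha> n" using n by auto
      have "n \<in> Zplus" using n SZ by auto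
      then have "norming \<alpha> n \<ge> 0" by (intro norming_nonneg) (auto simp: Zplus_def)
      \<comment> \<open>The norming vanishes when \<open>mabs n = 1\<close>; the quotient is then 0
        by convention, below \<open>c > 0\<close>.\<close>
      then show "T n \<omega> / norming \<alpha> n \<le> c"
        using le \<open>c > 0\<close> by (cases "norming \<alpha> n = 0") (auto simp: pos_divide_le_eq)
    qed
  qed
qed

lemma AE_Limsup_le:
  assumes "\<alpha> * p / 2 - \<alpha> > (1 - \<alpha>) / \<beta>" and "integrable M (\<lambda>\<omega>. \<bar>X0 \<omega>\<bar> powr p)"
  shows "AE \<omega> in M. Limsup (multi_at_top_in (Lambda_star \<alpha> \<beta>)) (\<lambda>n. ereal (T n \<omega> / norming \<alpha> n))
     \<le> ereal (\<sigma> * sqrt ((1 - \<alpha>) / \<beta>))"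
proof -
  let ?x = "\<sigma> * sqrt ((1 - \<alpha>) / \<beta>)"
  have "AE \<omega> in M. \<forall>k::nat. eventually (\<lambda>n. T n \<omega> / norming \<alpha> n \<le> ?x + 1 / Suc k) (multi_at_top_in (Lambda_star \<alpha> \<beta>))"
    unfolding AE_all_countable by (intro allI AE_eventually_T_le[OF assms]) simp
  then show ?thesis
  proof (rule AE_mp, intro AE_I2 impI)
    fix \<omega> assume *: "\<forall>k::nat. eventually (\<lambda>n. T n \<omega> / norming \<alpha> n \<le> ?x + 1 / Suc k) (multi_at_top_in (Lambda_star \<alpha> \<beta>))"
    have L: "(\<lambda>k. ereal (?x + 1 / Suc k)) \<longlonglongrightarrow> ereal (?x + 0)"
      by (intro tendsto_ereal tendsto_add tendsto_const LIMSEQ_Suc[OF lim_1_over_n])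
    have "Limsup (multi_at_top_in (Lambda_star \<alpha> \<beta>)) (\<lambda>n. ereal (T n \<omega> / norming \<alpha> n)) \<le> ereal (?x + 0)"
    proof (rule LIMSEQ_le_const[OF L], intro exI[of _ 0] allI impI Limsup_bounded)
      fix k
      show "eventually (\<lambda>n. ereal (T n \<omega> / norming \<alpha> n) \<le> ereal (?x + 1 / Suc k)) (multi_at_top_in (Lambda_star \<alpha> \<beta>))"
        unfolding ereal_less_eq using * by blast
    qed
    then show "Limsup (multi_at_top_in (Lambda_star \<alpha> \<beta>)) (\<lambda>n. ereal (T n \<omega> / norming \<alpha> n)) \<le> ereal ?x"
      by simp
  qed
qed

section \<open>Lower bound for the upper limit\<close>

text \<open>The moderate deviation bound is used at a level \<open>c1\<close> slightly above
  \<open>c\<close>; the surplus compensates for the block having fewer than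
  \<open>mabs n powr \<alpha>\<close> points after rounding.\<close>

lemma prob_T_ge:
  assumes "\<sigma> > 0" and c: "0 < c" "c < \<sigma> * sqrt ((1 - \<alpha>) / \<beta>)"
  shows "\<exists>C>0. \<exists>N. \<forall>n. (\<forall>i. N \<le> n i) \<longrightarrow>
    C * real (mabs n) powr (- ((1 - \<alpha>) / \<beta>)) \<le> prob {\<omega>\<in>space M. T n \<omega> > c * norming \<alpha> n}"
proof -
  define \<tau> where "\<tau> = (1 - \<alpha>) / \<beta>"
  have "\<tau> > 0" using \<alpha> \<beta> by (simp add: \<tau>_def)
  define x where "x = \<sigma> * sqrt \<tau>"
  have x2: "x\<^sup>2 / \<sigma>\<^sup>2 = \<tau>" using \<open>\<sigma> > 0\<close> \<open>\<tau> > 0\<close> by (simp add: x_def power_mult_distrib)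
  have "c < x" using c by (simp add: x_def \<tau>_def)
  then obtain c1 where c1: "c < c1" "c1 < x" using dense by blast
  have "c1 > 0" using c c1 by linarith
  \<comment> \<open>With \<open>(1 + \<delta>) * c1 = x\<close> the exponent in the deviation bound
    is exactly \<open>\<tau>\<close>.\<close>
  define \<delta> where "\<delta> = x / c1 - 1"
  have "\<delta> > 0" using c1 \<open>c1 > 0\<close> by (simp add: \<delta>_def)
  have \<delta>: "(1 + \<delta>)\<^sup>2 * c1\<^sup>2 / \<sigma>\<^sup>2 = \<tau>" using x2 \<open>c1 > 0\<close> by (simp add: \<delta>_def power_divide)
  have "infinite (Zplus :: ('d \<Rightarrow> nat) set)"
  proof
    assume "finite (Zplus :: ('d \<Rightarrow> nat) set)"
    then have "finite (range (\<lambda>k (_::'d). Suc k))" by (rule finite_subset[rotated]) (auto simp: Zplus_def)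
    then have "finite (UNIV :: nat set)" by (rule finite_imageD) (auto intro!: inj_onI dest: fun_cong)
    then show False by simp
  qed
  then obtain C R where "C > 0" and CR: "\<And>J L. finite J \<Longrightarrow> J \<subseteq> Zplus \<Longrightarrow> 1 \<le> L \<Longrightarrow> R * L \<le> real (card J) \<Longrightarrow>
     C * exp (- (\<tau> * L)) \<le> prob {\<omega>\<in>space M. (\<Sum>j\<in>J. X j \<omega>) > c1 * sqrt (2 * real (card J) * L)}"
    using moderate_deviation_lower_bound[OF _ sq mean var \<open>\<sigma> > 0\<close> \<open>c1 > 0\<close> \<open>\<delta> > 0\<close>] unfolding \<delta> by blast
  \<comment> \<open>The fraction of \<open>mabs n powr \<alpha>\<close> that the block must contain
    for level \<open>c1\<close> to imply level \<open>c\<close>; its root \<open>\<kappa>\<close> of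
    order the dimension is the share required of each coordinate.\<close>
  define \<rho> where "\<rho> = (c / c1)\<^sup>2"
  have \<rho>: "0 < \<rho>" "\<rho> < 1" using c c1 \<open>c1 > 0\<close> by (auto simp: \<rho>_def power_less_one_iff)
  define \<kappa> where "\<kappa> = root CARD('d) \<rho>"
  have \<kappa>: "0 < \<kappa>" "\<kappa> < 1" "\<kappa> ^ CARD('d) = \<rho>" using \<rho> by (auto simp: \<kappa>_def)
  have "\<forall>\<^sub>F x::real in at_top. (1 - \<kappa>) * x powr \<alpha> \<ge> 1"
    using \<kappa> \<alpha> by real_asymp
  moreover have "\<forall>\<^sub>F x::real in at_top. ln x \<ge> 1" by real_asymp
  moreover have "\<forall>\<^sub>F x::real in at_top. R * ln x \<le> \<rho> * x powr \<alpha>"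
    using \<rho> \<alpha> by real_asymp
  ultimately have "\<forall>\<^sub>F x::real in at_top. (1 - \<kappa>) * x powr \<alpha> \<ge> 1 \<and> ln x \<ge> 1 \<and> R * ln x \<le> \<rho> * x powr \<alpha>"
    by eventually_elim simp
  then obtain B where B: "\<And>x::real. x \<ge> B \<Longrightarrow> (1 - \<kappa>) * x powr \<alpha> \<ge> 1 \<and> ln x \<ge> 1 \<and> R * ln x \<le> \<rho> * x powr \<alpha>"
    by (auto simp: eventually_at_top_linorder)
  define N where "N = max 1 (nat \<lceil>B\<rceil>)"
  show ?thesis
  proof (rule exI[of _ C], rule conjI[OF \<open>C > 0\<close>], rule exI[of _ N], intro allI impI)
    fix n :: "'d \<Rightarrow> nat" assume "\<forall>i. N \<le> n i"
    then have n1: "n i \<ge> 1" and nB: "real (n i) \<ge> B" for i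
      using le_trans[of N "n i"] by (auto simp: N_def nat_le_iff ceiling_le_iff)
    let ?J = "{j. \<forall>i. n i < j i \<and> j i \<le> n i + mpow n \<alpha> i}"
    define L where "L = ln (real (mabs n))"
    have "n undefined \<le> mabs n" by (rule mabs_ge) (rule n1)
    then have "real (mabs n) \<ge> B" using nB[of undefined] by linarith
    then have L: "L \<ge> 1" "R * L \<le> \<rho> * real (mabs n) powr \<alpha>" using B by (auto simp: L_def)
    have "\<rho> * real (mabs n) powr \<alpha> = (\<Prod>i\<in>UNIV. \<kappa> * real (n i) powr \<alpha>)"
      by (simp add: real_mabs_powr prod.distrib \<kappa>)
    also have "\<dots> \<le> (\<Prod>i\<in>UNIV. real (mpow n \<alpha> i))"
    proof (rule prod_mono, intro conjI)
      fix i
      show "0 \<le> \<kappa> * real (n i) powr \<alpha>" using \<kappa> by simp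
      have "(1 - \<kappa>) * real (n i) powr \<alpha> \<ge> 1" using B[OF nB] by simp
      then have "\<kappa> * real (n i) powr \<alpha> \<le> real (n i) powr \<alpha> - 1" by (simp add: algebra_simps)
      also have "\<dots> \<le> real (mpow n \<alpha> i)" by (simp add: mpow_def)
      finally show "\<kappa> * real (n i) powr \<alpha> \<le> real (mpow n \<alpha> i)" .
    qed
    finally have K: "\<rho> * real (mabs n) powr \<alpha> \<le> real (card ?J)" by (simp add: card_box)
    have "C * real (mabs n) powr (- \<tau>) = C * exp (- (\<tau> * L))"
      using \<open>L \<ge> 1\<close> by (auto simp: powr_def L_def)
    also have "\<dots> \<le> prob {\<omega>\<in>space M. (\<Sum>j\<in>?J. X j \<omega>) > c1 * sqrt (2 * real (card ?J) * L)}"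
      using L K by (intro CR finite_box box_subset_Zplus) auto
    also have "\<dots> \<le> prob {\<omega>\<in>space M. T n \<omega> > c * norming \<alpha> n}"
    proof (rule finite_measure_mono)
      have "c = c1 * sqrt \<rho>" using c \<open>c1 > 0\<close> by (simp add: \<rho>_def)
      then have "c * norming \<alpha> n = c1 * sqrt (2 * (\<rho> * real (mabs n) powr \<alpha>) * L)"
        by (simp add: norming_def L_def real_sqrt_mult)
      also have "\<dots> \<le> c1 * sqrt (2 * real (card ?J) * L)"
        using K L \<open>c1 > 0\<close> by (intro mult_left_mono real_sqrt_le_mono mult_right_mono) auto
      finally show "{\<omega>\<in>space M. (\<Sum>j\<in>?J. X j \<omega>) > c1 * sqrt (2 * real (card ?J) * L)} \<subseteq> {\<omega>\<in>space M. T n \<omega> > c * norming \<alpha> n}"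
        by (auto simp: Tsum_def)
    qed measurable
    finally show "C * real (mabs n) powr (- ((1 - \<alpha>) / \<beta>)) \<le> prob {\<omega>\<in>space M. T n \<omega> > c * norming \<alpha> n}"
      by (simp add: \<tau>_def)
  qed
qed

text \<open>Already the indices with all coordinates but one fixed produce a divergent series.\<close>

lemma AE_frequently_T_ge:
  assumes "\<sigma> > 0" and c: "0 < c" "c < \<sigma> * sqrt ((1 - \<alpha>) / \<beta>)"
  shows "AE \<omega> in M. \<exists>n. (\<forall>i. N \<le> n i \<and> n i \<in> Lambda_star \<alpha> \<beta>) \<and> T n \<omega> > c * norming \<alpha> n"
proof -
  define \<tau> where "\<tau> = (1 - \<alpha>) / \<beta>"
  define g where "g = \<beta> / (1 - \<alpha>)"
  have "\<tau> > 0" "g > 0" "g * \<tau> = 1" using \<alpha> \<beta> by (auto simp: \<tau>_def g_def)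
  obtain C N0 where "C > 0" and C: "\<And>n. (\<And>i. N0 \<le> n i) \<Longrightarrow>
      C * real (mabs n) powr (- \<tau>) \<le> prob {\<omega>\<in>space M. T n \<omega> > c * norming \<alpha> n}"
    using prob_T_ge[OF assms] unfolding \<tau>_def by blast
  obtain k0 where k0: "\<And>k. k \<ge> k0 \<Longrightarrow> max N N0 \<le> floor_powr g k"
    using floor_powr_unbounded[OF \<open>g > 0\<close>] by blast
  obtain k1 where k1: "\<And>k. k \<ge> k1 \<Longrightarrow> floor_powr g k + nat \<lfloor>real (floor_powr g k) powr \<alpha>\<rfloor> \<le> floor_powr g (Suc k)"
    using floor_powr_gap[OF \<alpha> \<beta>] unfolding g_def by blast
  \<comment> \<open>The successor makes every index \<open>k + k2\<close> at least 1, as membership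
    in \<open>Lambda_star\<close> requires.\<close>
  define k2 where "k2 = Suc (max k0 k1)"
  define i0 :: 'd where "i0 = undefined"
  define A where "A = floor_powr g k2"
  define n where "n k = (\<lambda>i. if i = i0 then floor_powr g (k + k2) else A)" for k
  have nL: "N \<le> n k i" "N0 \<le> n k i" "n k i \<in> Lambda_star \<alpha> \<beta>" for k i
    using k0[of k2] k0[of "k + k2"] by (auto simp: n_def A_def k2_def Lambda_star_eq g_def)
  have gap: "floor_powr g (k + k2) + nat \<lfloor>real (floor_powr g (k + k2)) powr \<alpha>\<rfloor> \<le> floor_powr g (l + k2)" if "k < l" for k l
    by (rule order_trans[OF k1 floor_powr_mono]) (use that \<open>g > 0\<close> in \<open>auto simp: k2_def\<close>)
  let ?J = "\<lambda>k. {j. \<forall>i. n k i < j i \<and> j i \<le> n k i + mpow (n k) \<alpha> i}"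
  \<comment> \<open>Separation in the single varying coordinate \<open>i0\<close> makes the boxes
    disjoint.\<close>
  have dis: "?J k \<inter> ?J l = {}" if "k < l" for k l
  proof (rule equals0I)
    fix j assume "j \<in> ?J k \<inter> ?J l"
    then have "j i0 \<le> n k i0 + mpow (n k) \<alpha> i0" "n l i0 < j i0" by auto
    then show False using gap[OF that] by (simp add: n_def mpow_def)
  qed
  have "disjoint_family_on ?J UNIV"
    unfolding disjoint_family_on_def
  proof (intro ballI impI)
    fix k l :: nat assume "k \<noteq> l"
    then consider "k < l" | "l < k" by linarith
    then show "?J k \<inter> ?J l = {}"
    proof cases
      case 1
      then show ?thesis by (rule dis)
    next
      case 2
      then show ?thesis using dis[of l k] by (simp only: Int_commute)
    qed
  qed
  then have "indep_vars (\<lambda>_. borel) (\<lambda>k \<omega>. \<Sum>j\<in>?J k. X j \<omega>) UNIV"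
    by (intro indep_vars_block_sums[OF indep] box_subset_Zplus)
  then have ind: "indep_vars (\<lambda>_. borel) (\<lambda>k. T (n k)) UNIV"
    by (simp add: Tsum_def[abs_def])
  let ?p = "\<lambda>k. prob {\<omega>\<in>space M. T (n k) \<omega> > c * norming \<alpha> (n k)}"
  have "A \<ge> 1" using \<open>g > 0\<close> unfolding A_def by (intro floor_powr_ge_1) (auto simp: k2_def)
  define D where "D = C * real (A ^ (CARD('d) - 1)) powr (- \<tau>)"
  have "D > 0" using \<open>C > 0\<close> \<open>A \<ge> 1\<close> by (simp add: D_def)
  \<comment> \<open>Since \<open>g * \<tau> = 1\<close>, the varying coordinate contributes at least
    a term of the harmonic series; the fixed coordinates enter only the constant \<open>D\<close>.
    Rounding down helps, as the exponent is negative.\<close>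
  have pk: "D * inverse (real (k + k2)) \<le> ?p k" for k
  proof -
    have l1: "floor_powr g (k + k2) \<ge> 1" using \<open>g > 0\<close> by (intro floor_powr_ge_1) (auto simp: k2_def)
    have "mabs (n k) = n k i0 * (\<Prod>i\<in>UNIV-{i0}. n k i)"
      unfolding mabs_def by (rule prod.remove) auto
    also have "(\<Prod>i\<in>UNIV-{i0}. n k i) = A ^ (CARD('d) - 1)"
      by (simp add: n_def)
    finally have "real (mabs (n k)) = real (A ^ (CARD('d) - 1)) * real (floor_powr g (k + k2))" by (simp add: n_def)
    then have m: "C * real (mabs (n k)) powr (- \<tau>) = D * real (floor_powr g (k + k2)) powr (- \<tau>)"
      by (simp add: D_def powr_mult)
    have "inverse (real (k + k2)) = (real (k + k2) powr g) powr (- \<tau>)"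
      using \<open>g * \<tau> = 1\<close> by (simp add: powr_powr powr_minus k2_def)
    also have "\<dots> \<le> real (floor_powr g (k + k2)) powr (- \<tau>)"
      using l1 \<open>\<tau> > 0\<close> by (intro powr_mono2' floor_powr_le) auto
    finally have "D * inverse (real (k + k2)) \<le> D * real (floor_powr g (k + k2)) powr (- \<tau>)"
      using \<open>D > 0\<close> by (intro mult_left_mono) auto
    also have "\<dots> \<le> ?p k" using C[of "n k"] nL(2) m by simp
    finally show ?thesis .
  qed
  have "\<not> summable ?p"
  proof
    assume "summable ?p"
    then have "summable (\<lambda>k. D * inverse (real (k + k2)))"
      by (rule summable_comparison_test') (use pk \<open>D > 0\<close> in auto)
    then have "summable (\<lambda>k. inverse (real (k + k2)))" using \<open>D > 0\<close> by (simp add: summable_cmult_iff)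
    then have "summable (\<lambda>k. inverse (real k))"
      using summable_iff_shift[of "\<lambda>k. inverse (real k)" k2] by blast
    then show False using not_summable_harmonic[where 'a=real] by blast
  qed
  from AE_exists_exceedance[OF ind this] show ?thesis
  proof eventually_elim
    case (elim \<omega>)
    then obtain k where "T (n k) \<omega> > c * norming \<alpha> (n k)" by auto
    then show ?case using nL(1,3) by (intro exI[of _ "n k"]) auto
  qed
qed

lemma AE_le_Limsup:
  assumes "\<sigma> > 0"
  shows "AE \<omega> in M. ereal (\<sigma> * sqrt ((1 - \<alpha>) / \<beta>))
     \<le> Limsup (multi_at_top_in (Lambda_star \<alpha> \<beta>)) (\<lambda>n. ereal (T n \<omega> / norming \<alpha> n))"
proof -
  let ?x = "\<sigma> * sqrt ((1 - \<alpha>) / \<beta>)"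
  \<comment> \<open>A countable sequence of levels increasing to \<open>?x\<close>; the summand 2
    keeps the first one positive.\<close>
  let ?c = "\<lambda>k::nat. ?x * (1 - 1 / (real k + 2))"
  let ?F = "multi_at_top_in (Lambda_star \<alpha> \<beta>)"
  have "?x > 0" using assms \<alpha> \<beta> by simp
  have "0 < 1 - 1 / (real k + 2)" "1 - 1 / (real k + 2) < 1" for k by auto
  then have c: "0 < ?c k" "?c k < ?x" for k
    using mult_pos_pos[OF \<open>?x > 0\<close>] mult_strict_left_mono[OF _ \<open>?x > 0\<close>, of _ 1] by auto
  have "AE \<omega> in M. \<forall>k N. \<exists>n. (\<forall>i. N \<le> n i \<and> n i \<in> Lambda_star \<alpha> \<beta>) \<and> T n \<omega> > ?c k * norming \<alpha> n"
    unfolding AE_all_countable using c by (intro allI AE_frequently_T_ge[OF assms])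
  then show ?thesis
  proof (rule AE_mp, intro AE_I2 impI)
    fix \<omega> assume *: "\<forall>k N. \<exists>n. (\<forall>i. N \<le> n i \<and> n i \<in> Lambda_star \<alpha> \<beta>) \<and> T n \<omega> > ?c k * norming \<alpha> n"
    have ge: "ereal (?c k) \<le> Limsup ?F (\<lambda>n. ereal (T n \<omega> / norming \<alpha> n))" for k
    proof (rule ccontr)
      assume "\<not> ?thesis"
      then have "eventually (\<lambda>n. ereal (T n \<omega> / norming \<alpha> n) < ereal (?c k)) ?F"
        by (intro Limsup_lessD) (simp add: not_le)
      then obtain N where N: "\<And>n. (\<forall>i. N \<le> n i \<and> n i \<in> Lambda_star \<alpha> \<beta>) \<Longrightarrow> T n \<omega> / norming \<alpha> n < ?c k"
        unfolding eventually_multi_at_top_in by auto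
      \<comment> \<open>Coordinates of at least 2 make \<open>ln (mabs n)\<close>, hence the
        norming, positive.\<close>
      obtain n where n: "\<forall>i. max N 2 \<le> n i \<and> n i \<in> Lambda_star \<alpha> \<beta>" "T n \<omega> > ?c k * norming \<alpha> n"
        using * by blast
      have n2: "n i \<ge> 2" for i using n(1) by simp
      have "mabs n \<ge> 2" using mabs_ge[of n undefined] n2 by (meson le_trans one_le_numeral)
      then have "norming \<alpha> n > 0" by (simp add: norming_def)
      then have "T n \<omega> / norming \<alpha> n > ?c k" using n(2) by (simp only: pos_less_divide_eq)
      moreover have "T n \<omega> / norming \<alpha> n < ?c k" using n(1) by (intro N) auto
      ultimately show False by linarith
    qed
    have "(\<lambda>k::nat. 1 - 1 / (real k + 2)) \<longlonglongrightarrow> 1" by real_asymp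
    then have L: "(\<lambda>k. ereal (?c k)) \<longlonglongrightarrow> ereal (?x * 1)"
      by (intro tendsto_ereal tendsto_mult tendsto_const)
    have "ereal (?x * 1) \<le> Limsup ?F (\<lambda>n. ereal (T n \<omega> / norming \<alpha> n))"
      by (rule LIMSEQ_le_const2[OF L]) (intro exI[of _ 0] allI impI ge)
    then show "ereal ?x \<le> Limsup ?F (\<lambda>n. ereal (T n \<omega> / norming \<alpha> n))"
      by simp
  qed
qed

end

section \<open>Conclusion for both limits\<close>

text \<open>\<open>Lambda_star\<close> is unbounded. Nontriviality of the filter gives that the
  lower limit is at most the upper one, which settles \<open>\<sigma> = 0\<close>.\<close>

lemma multi_at_top_in_Lambda_star_neq_bot:
  assumes "0 < \<alpha>" "\<alpha> < 1" "1 < \<beta>"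
  shows "(multi_at_top_in (Lambda_star \<alpha> \<beta>) :: ('d::finite \<Rightarrow> nat) filter) \<noteq> bot"
proof
  assume "(multi_at_top_in (Lambda_star \<alpha> \<beta>) :: ('d \<Rightarrow> nat) filter) = bot"
  then have "eventually (\<lambda>_. False) (multi_at_top_in (Lambda_star \<alpha> \<beta>) :: ('d \<Rightarrow> nat) filter)" by simp
  then obtain N where N: "\<And>n::'d \<Rightarrow> nat. \<exists>i. \<not> (N \<le> n i \<and> n i \<in> Lambda_star \<alpha> \<beta>)"
    unfolding eventually_multi_at_top_in by blast
  obtain k0 where k0: "\<forall>k\<ge>k0. N \<le> floor_powr (\<beta> / (1 - \<alpha>)) k"
    using floor_powr_unbounded[of "\<beta> / (1 - \<alpha>)" N] assms by auto
  show False using N[of "\<lambda>_. floor_powr (\<beta> / (1 - \<alpha>)) (Suc k0)"] k0 by (auto simp: Lambda_star_eq)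
qed

theorem theorem6p1:
  fixes M :: "'a measure"
    and X :: "('d::finite \<Rightarrow> nat) \<Rightarrow> 'a \<Rightarrow> real"
    and X0 :: "'a \<Rightarrow> real"
    and \<alpha> \<beta> \<sigma> :: real
  assumes "prob_space M"
    and "0 < \<alpha>" "\<alpha> < 1" "1 < \<beta>"
    and "X0 \<in> borel_measurable M"
    and "\<forall>k\<in>Zplus. X k \<in> borel_measurable M"
    and "prob_space.indep_vars M (\<lambda>_. borel) X Zplus"
    and "\<forall>k\<in>Zplus. distr M borel (X k) = distr M borel X0"
    and "integrable M (\<lambda>\<omega>. (X0 \<omega>)\<^sup>2)"
    and "prob_space.expectation M X0 = 0"
    and "0 \<le> \<sigma>" "prob_space.variance M X0 = \<sigma>\<^sup>2"
    and "integrable M (\<lambda>\<omega>. \<bar>X0 \<omega>\<bar> powr (2 / \<alpha>)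
                             * logp \<bar>X0 \<omega>\<bar> powr (real CARD('d) - 1 - 1 / \<alpha>))"
  shows "AE \<omega> in M.
      Limsup (multi_at_top_in (Lambda_star \<alpha> \<beta>))
        (\<lambda>n. ereal (Tsum X n (mpow n \<alpha>) \<omega>
                     / sqrt (2 * real (mabs n) powr \<alpha> * ln (real (mabs n)))))
        = ereal (\<sigma> * sqrt ((1 - \<alpha>) / \<beta>))
    \<and> Liminf (multi_at_top_in (Lambda_star \<alpha> \<beta>))
        (\<lambda>n. ereal (Tsum X n (mpow n \<alpha>) \<omega>
                     / sqrt (2 * real (mabs n) powr \<alpha> * ln (real (mabs n)))))
        = ereal (- \<sigma> * sqrt ((1 - \<alpha>) / \<beta>))"
proof -
  interpret prob_space M by fact
  note [measurable] = assms(5)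
  interpret P: iid_field M X X0 \<alpha> \<beta> \<sigma>
    by unfold_locales (use assms in auto)
  define X' where "X' k \<omega> = - X k \<omega>" for k \<omega>
  have X'_distr: "distr M borel (X' k) = distr M borel (\<lambda>\<omega>. - X0 \<omega>)" if "k \<in> Zplus" for k
  proof -
    have [measurable]: "X k \<in> borel_measurable M" using assms(6) that by blast
    have "distr (distr M borel (X k)) borel uminus = distr (distr M borel X0) borel uminus"
      using assms(8) that by simp
    then show ?thesis by (simp add: distr_distr comp_def X'_def[abs_def])
  qed
  have X'_indep: "indep_vars (\<lambda>_. borel) X' Zplus"
    unfolding X'_def[abs_def] by (rule indep_vars_compose2[OF assms(7)]) measurable
  interpret N: iid_field M X' "\<lambda>\<omega>. - X0 \<omega>" \<alpha> \<beta> \<sigma>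
    by unfold_locales (use assms X'_distr X'_indep in auto)
  \<comment> \<open>The left side is the order \<open>p\<close> at which
    \<open>\<alpha> * p / 2 - \<alpha>\<close> equals \<open>(1 - \<alpha>) / \<beta>\<close>. It
    would equal \<open>2 / \<alpha>\<close> for \<open>\<beta> = 1\<close>, so
    \<open>\<beta> > 1\<close> leaves room for a moment of lower order.\<close>
  have "2 + 2 * (1 - \<alpha>) / (\<alpha> * \<beta>) < 2 / \<alpha>"
  proof -
    have "2 * (1 - \<alpha>) / (\<alpha> * \<beta>) < 2 * (1 - \<alpha>) / \<alpha>"
      using assms(2-4) by (intro divide_strict_left_mono) auto
    moreover have "2 * (1 - \<alpha>) / \<alpha> = 2 / \<alpha> - 2" using assms(2) by (simp add: field_simps)
    ultimately show ?thesis by linarith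
  qed
  then obtain p where p: "2 + 2 * (1 - \<alpha>) / (\<alpha> * \<beta>) < p" "p < 2 / \<alpha>" using dense by blast
  have "0 \<le> 2 * (1 - \<alpha>) / (\<alpha> * \<beta>)" using assms(2-4) by simp
  then have "p > 0" using p by linarith
  have p': "\<alpha> * p / 2 - \<alpha> > (1 - \<alpha>) / \<beta>"
  proof -
    have "\<alpha> / 2 * (2 + 2 * (1 - \<alpha>) / (\<alpha> * \<beta>)) < \<alpha> / 2 * p"
      using p(1) assms(2) by (intro mult_strict_left_mono) auto
    moreover have "\<alpha> / 2 * (2 + 2 * (1 - \<alpha>) / (\<alpha> * \<beta>)) = \<alpha> + (1 - \<alpha>) / \<beta>"
      using assms(2-4) by (simp add: field_simps)
    ultimately show ?thesis by linarith
  qed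
  have mom: "integrable M (\<lambda>\<omega>. \<bar>X0 \<omega>\<bar> powr p)"
    using integrable_powr_of_log_weight[OF _ assms(5) \<open>p > 0\<close> p(2) assms(13)] finite_measure_axioms by blast
  let ?F = "multi_at_top_in (Lambda_star \<alpha> \<beta>) :: ('d \<Rightarrow> nat) filter"
  let ?x = "\<sigma> * sqrt ((1 - \<alpha>) / \<beta>)"
  let ?f = "\<lambda>\<omega> n. ereal (Tsum X n (mpow n \<alpha>) \<omega> / norming \<alpha> n)"
  let ?f' = "\<lambda>\<omega> n. ereal (Tsum X' n (mpow n \<alpha>) \<omega> / norming \<alpha> n)"
  have f': "?f' \<omega> = (\<lambda>n. - ?f \<omega> n)" for \<omega>
    by (simp add: Tsum_def X'_def sum_negf fun_eq_iff)
  have lim: "Limsup ?F (?f' \<omega>) = - Liminf ?F (?f \<omega>)" for \<omega>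
    unfolding f' by (rule ereal_Limsup_uminus)
  have up: "AE \<omega> in M. Limsup ?F (?f \<omega>) \<le> ereal ?x" by (rule P.AE_Limsup_le[OF p' mom])
  have up': "AE \<omega> in M. Limsup ?F (?f' \<omega>) \<le> ereal ?x" by (rule N.AE_Limsup_le[OF p']) (use mom in simp)
  have "AE \<omega> in M. Limsup ?F (?f \<omega>) = ereal ?x \<and> Liminf ?F (?f \<omega>) = - ereal ?x"
  proof (cases "\<sigma> = 0")
    \<comment> \<open>The upper bounds for the field and its negative squeeze both limits to
      0.\<close>
    case True
    from up up' show ?thesis
    proof eventually_elim
      case (elim \<omega>)
      have "Liminf ?F (?f \<omega>) \<le> Limsup ?F (?f \<omega>)"
        using multi_at_top_in_Lambda_star_neq_bot[OF assms(2-4)] by (intro Liminf_le_Limsup) auto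
      moreover have "0 \<le> Liminf ?F (?f \<omega>)" "Limsup ?F (?f \<omega>) \<le> 0"
        using elim True unfolding lim by (auto simp: zero_ereal_def[symmetric])
      ultimately show ?case using True by (auto simp: zero_ereal_def[symmetric])
    qed
  next
    case False
    then have "\<sigma> > 0" using assms(11) by simp
    from up up' P.AE_le_Limsup[OF this] N.AE_le_Limsup[OF this] show ?thesis
    proof eventually_elim
      case (elim \<omega>)
      then have "Limsup ?F (?f \<omega>) = ereal ?x" "Limsup ?F (?f' \<omega>) = ereal ?x" by (auto intro: antisym)
      then show ?case unfolding lim by (metis ereal_uminus_uminus)
    qed
  qed
  then show ?thesis by (simp add: norming_def)
qed

end
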